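(* Consider a combinatorial problem class where an instance specifies a nonempty feasible set $\mathcal{X}\subseteq\{0,1\}^n$ (via a compact encoding). For scenarios $c_1,\dots,c_K\in\mathbb{R}^n$ let $opt(c)=\min_{y\in\mathcal{X}}c^ty$; the min-max regret problem is $\min_{x\in\mathcal{X}}\max_{i\in[K]}(c_i^tx-opt(c_i))$. A generalized min-max regret problem is $\min_{x\in\mathcal{X}}\max_{i\in[\tilde K]}(\tilde c_i^tx-d_i)$ for given cost vectors $\tilde c_i$ and reals $d_i$. Let a constant $0<\varepsilon\le1$ be given. If for every fixed number $\tilde K$ of scenarios there is a polynomial-time $2$-approximation algorithm for the generalized min-max regret problem, then there is a polynomial-time algorithm (with $K$ unbounded) that returns a feasible solution which is an $(\varepsilon K)$-approximation for the min-max regret problem.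
   Context: An $\alpha$-approximation is a feasible solution whose objective value is at most $\alpha$ times the optimal objective value of the respective problem.
   Formalization: Since an α-approximation need not exist (negative optimum with α=2, or εK<1 with positive optimal regret), the algorithms must always return a feasible solution in polynomial time and an α-approximation whenever one exists; cost vectors and constants given to algorithms are rational. *)

theory Defs
  imports Complex_Main "HOL-Library.Log_Nat" "HOL-Computational_Algebra.Polynomial"
begin

section \<open>Polynomial-time computation\<close>

text \<open>
  Algorithms are programs of a small first-order language that transforms binary trees with
  integer leaves, under the logarithmic cost criterion: every primitive operation is charged the
  number of bits of its argument and of its result. Argument, result and all intermediate values
  are thus never larger than the running time, and every primitive operation is computable in
  polynomial time on a Turing machine, so that polynomial time in this model is polynomial time
  on Turing machines.
\<close>

datatype tree = Leaf int | Node tree tree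

fun tsize :: "tree \<Rightarrow> nat" where
  "tsize (Leaf i) = 1 + nat (bitlen \<bar>i\<bar>)"
| "tsize (Node u v) = 1 + tsize u + tsize v"

datatype prim = Ident | Const tree | Fst | Snd | IsNode | Add | Sub | Mul | Div | Leq

fun arith :: "(int \<Rightarrow> int \<Rightarrow> int) \<Rightarrow> tree \<Rightarrow> tree" where
  "arith f (Node (Leaf a) (Leaf b)) = Leaf (f a b)"
| "arith f v = Leaf 0"

fun prim_fun :: "prim \<Rightarrow> tree \<Rightarrow> tree" where
  "prim_fun Ident v = v"
| "prim_fun (Const c) v = c"
| "prim_fun Fst v = (case v of Leaf i \<Rightarrow> Leaf 0 | Node a b \<Rightarrow> a)"
| "prim_fun Snd v = (case v of Leaf i \<Rightarrow> Leaf 0 | Node a b \<Rightarrow> b)"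
| "prim_fun IsNode v = (case v of Leaf i \<Rightarrow> Leaf 0 | Node a b \<Rightarrow> Leaf 1)"
| "prim_fun Add v = arith (+) v"
| "prim_fun Sub v = arith (-) v"
| "prim_fun Mul v = arith (*) v"
| "prim_fun Div v = arith (div) v"
| "prim_fun Leq v = arith (\<lambda>a b. of_bool (a \<le> b)) v"

datatype prog =
  Prim prim
| Seq prog prog
| Fork prog prog
| Cond prog prog prog
| While prog prog

text \<open>
  \<open>run P v w t\<close>: on input \<open>v\<close> the program \<open>P\<close> halts with output \<open>w\<close> after time \<open>t\<close>.
  The tree \<open>Leaf 0\<close> is the truth value false, every other tree is true.
\<close>

inductive run :: "prog \<Rightarrow> tree \<Rightarrow> tree \<Rightarrow> nat \<Rightarrow> bool" where
  run_Prim: "run (Prim p) v (prim_fun p v) (tsize v + tsize (prim_fun p v))"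
| run_Seq: "run P v u s \<Longrightarrow> run Q u w t \<Longrightarrow> run (Seq P Q) v w (s + t)"
| run_Fork: "run P v u s \<Longrightarrow> run Q v w t \<Longrightarrow> run (Fork P Q) v (Node u w) (s + t + 1)"
| run_Cond_True: "run B v b r \<Longrightarrow> b \<noteq> Leaf 0 \<Longrightarrow> run P v w t \<Longrightarrow> run (Cond B P Q) v w (r + t)"
| run_Cond_False: "run B v (Leaf 0) r \<Longrightarrow> run Q v w t \<Longrightarrow> run (Cond B P Q) v w (r + t)"
| run_While_False: "run B v (Leaf 0) r \<Longrightarrow> run (While B P) v v (r + tsize v)"
| run_While_True: "run B v b r \<Longrightarrow> b \<noteq> Leaf 0 \<Longrightarrow> run P v u s \<Longrightarrow> run (While B P) u w t \<Longrightarrow>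
    run (While B P) v w (r + s + t)"

lemma run_deterministic: "run P v w t \<Longrightarrow> run P v w' t' \<Longrightarrow> w' = w \<and> t' = t"
proof (induction arbitrary: w' t' rule: run.induct)
  case (run_Prim p v)
  then show ?case by (auto elim: run.cases)
next
  case (run_Seq P v u s Q w t)
  from run_Seq.prems show ?case
    by cases (use run_Seq.IH in blast)
next
  case (run_Fork P v u s Q w t)
  from run_Fork.prems show ?case
    by cases (use run_Fork.IH in blast)
next
  case (run_Cond_True B v b r P w t Q)
  from run_Cond_True.prems show ?case
    by cases (use run_Cond_True.IH run_Cond_True.hyps in blast)+
next
  case (run_Cond_False B v r Q w t P)
  from run_Cond_False.prems show ?case
    by cases (use run_Cond_False.IH in blast)+
next
  case (run_While_False B v r P)
  from run_While_False.prems show ?case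
    by cases (use run_While_False.IH in blast)+
next
  case (run_While_True B v b r P u s w t)
  from run_While_True.prems show ?case
    by cases (use run_While_True.IH run_While_True.hyps in blast)+
qed

lemma size_le_time: "run P v w t \<Longrightarrow> tsize v + tsize w \<le> t"
  by (induction rule: run.induct) auto

section \<open>Encodings\<close>

fun enc_list :: "('a \<Rightarrow> tree) \<Rightarrow> 'a list \<Rightarrow> tree" where
  "enc_list e [] = Leaf 0"
| "enc_list e (x # xs) = Node (e x) (enc_list e xs)"

definition enc_bits :: "bool list \<Rightarrow> tree" where
  "enc_bits = enc_list (\<lambda>b. Leaf (of_bool b))"

definition enc_rat :: "rat \<Rightarrow> tree" where
  "enc_rat r = (case quotient_of r of (p, q) \<Rightarrow> Node (Leaf p) (Leaf q))"

section \<open>Approximation algorithms\<close>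

definition approximation :: "real \<Rightarrow> 'x set \<Rightarrow> ('x \<Rightarrow> real) \<Rightarrow> 'x \<Rightarrow> bool" where
  "approximation \<alpha> S f x \<longleftrightarrow> x \<in> S \<and> f x \<le> \<alpha> * Min (f ` S)"

text \<open>
  An instance need not have an \<open>\<alpha>\<close>-approximation at all: there is none if \<open>\<alpha> > 1\<close> and the optimal
  value is negative, or if \<open>\<alpha> < 1\<close> and the optimal value is positive. On such an instance an
  algorithm is only required to return a feasible solution in polynomial time.

  Parameters: the program, the instances \<open>D\<close>, their encoding, feasible sets and objective
  functions, and the (instance-dependent) approximation ratio.
\<close>

definition poly_time_approx ::
  "prog \<Rightarrow> 'i set \<Rightarrow> ('i \<Rightarrow> tree) \<Rightarrow> ('i \<Rightarrow> int list set) \<Rightarrow> ('i \<Rightarrow> int list \<Rightarrow> real) \<Rightarrow>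
    ('i \<Rightarrow> real) \<Rightarrow> bool" where
  "poly_time_approx P D enc feas obj \<alpha> \<longleftrightarrow>
    (\<exists>q :: nat poly. \<forall>i \<in> D. \<exists>x t.
      run P (enc i) (enc_list Leaf x) t \<and> t \<le> poly q (tsize (enc i)) \<and>
      x \<in> feas i \<and>
      ((\<exists>y. approximation (\<alpha> i) (feas i) (obj i) y) \<longrightarrow> approximation (\<alpha> i) (feas i) (obj i) x))"

section \<open>Min-max regret problems\<close>

definition binary_vectors :: "nat \<Rightarrow> int list set" where
  "binary_vectors n = {x. length x = n \<and> set x \<subseteq> {0, 1}}"

text \<open>
  A problem class is given by the set \<open>inst\<close> of bit strings that encode an instance, and for each
  such string \<open>I\<close> by the dimension \<open>n I\<close> and the feasible set \<open>X I\<close> it specifies.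
\<close>

definition problem_class ::
  "bool list set \<Rightarrow> (bool list \<Rightarrow> nat) \<Rightarrow> (bool list \<Rightarrow> int list set) \<Rightarrow> bool" where
  "problem_class inst n X \<longleftrightarrow> (\<forall>I \<in> inst. X I \<noteq> {} \<and> X I \<subseteq> binary_vectors (n I))"

definition cost :: "real list \<Rightarrow> int list \<Rightarrow> real" where
  "cost c x = (\<Sum>j < length c. c ! j * of_int (x ! j))"

definition opt :: "int list set \<Rightarrow> real list \<Rightarrow> real" where
  "opt S c = Min (cost c ` S)"

definition max_regret :: "int list set \<Rightarrow> real list list \<Rightarrow> int list \<Rightarrow> real" where
  "max_regret S cs x = Max ((\<lambda>c. cost c x - opt S c) ` set cs)"

definition gen_max_regret :: "(real list \<times> real) list \<Rightarrow> int list \<Rightarrow> real" where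
  "gen_max_regret cds x = Max ((\<lambda>(c, d). cost c x - d) ` set cds)"

text \<open>
  Numbers in the input of an algorithm are rational, given by numerator and denominator in binary.
\<close>

definition regret_instances ::
  "bool list set \<Rightarrow> (bool list \<Rightarrow> nat) \<Rightarrow> (bool list \<times> rat list list) set" where
  "regret_instances inst n =
    {(I, cs). I \<in> inst \<and> cs \<noteq> [] \<and> (\<forall>c \<in> set cs. length c = n I)}"

definition enc_regret :: "bool list \<times> rat list list \<Rightarrow> tree" where
  "enc_regret = (\<lambda>(I, cs). Node (enc_bits I) (enc_list (enc_list enc_rat) cs))"

definition regret_obj ::
  "(bool list \<Rightarrow> int list set) \<Rightarrow> bool list \<times> rat list list \<Rightarrow> int list \<Rightarrow> real" where
  "regret_obj X = (\<lambda>(I, cs). max_regret (X I) (map (map real_of_rat) cs))"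

definition gen_instances ::
  "bool list set \<Rightarrow> (bool list \<Rightarrow> nat) \<Rightarrow> nat \<Rightarrow> (bool list \<times> (rat list \<times> rat) list) set" where
  "gen_instances inst n K =
    {(I, cds). I \<in> inst \<and> length cds = K \<and> (\<forall>(c, d) \<in> set cds. length c = n I)}"

definition enc_gen :: "bool list \<times> (rat list \<times> rat) list \<Rightarrow> tree" where
  "enc_gen = (\<lambda>(I, cds).
    Node (enc_bits I) (enc_list (\<lambda>(c, d). Node (enc_list enc_rat c) (enc_rat d)) cds))"

definition gen_obj :: "bool list \<times> (rat list \<times> rat) list \<Rightarrow> int list \<Rightarrow> real" where
  "gen_obj = (\<lambda>(I, cds). gen_max_regret (map (\<lambda>(c, d). (map real_of_rat c, real_of_rat d)) cds))"

end

theory Submission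
  imports Defs
begin

text \<open>
  The regrets are nonnegative, so if the \<open>K\<close> scenarios are split into \<open>G\<close> groups of at most
  \<open>\<lceil>K / G\<rceil>\<close> scenarios each, then the maximum over the groups of the summed regrets lies between the
  maximum regret and \<open>\<lceil>K / G\<rceil>\<close> times the maximum regret. The grouped problem is a generalized min-max
  regret problem with the constant number \<open>G = \<lceil>2 / \<epsilon>\<rceil>\<close> of scenarios, and an exact solution of it is an
  \<open>\<lceil>K / G\<rceil>\<close>-approximation of the original problem. If \<open>K > G\<close> then \<open>\<lceil>K / G\<rceil> \<le> 2 K / G \<le> \<epsilon> K\<close>;
  if \<open>K \<le> G\<close> then the solution is exact, hence an \<open>\<epsilon> K\<close>-approximation whenever there is one.

  The generalized problem with a fixed number of scenarios can be solved exactly because the constants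
  \<open>d\<^sub>i\<close> are arbitrary. Scale all costs to integers, and let \<open>v\<close> be the optimal value and \<open>l \<le> v\<close> a lower
  bound. A 2-approximation for the constants \<open>d\<^sub>i + l\<close> has a value \<open>h\<close> with \<open>v \<le> h\<close> and
  \<open>h - l \<le> 2 (v - l)\<close>, so \<open>\<lceil>(l + h) / 2\<rceil>\<close> is again a lower bound, and the gap to \<open>v\<close> has been halved;
  for \<open>l = v\<close> a 2-approximation is optimal. With a single scenario, this also computes \<open>opt(c\<^sub>i)\<close>.
\<close>

section \<open>Functions computable in polynomial time\<close>

definition pbound :: "'a set \<Rightarrow> ('a \<Rightarrow> tree) \<Rightarrow> ('a \<Rightarrow> nat) \<Rightarrow> bool" where
  "pbound D e B \<longleftrightarrow> (\<exists>q :: nat poly. \<forall>a \<in> D. B a \<le> poly q (tsize (e a)))"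

text \<open>
  Some program computes \<open>g a\<close> from the input \<open>e a\<close> in polynomial time, for all indices \<open>a \<in> D\<close>.
  With the input kept as a fixed environment, closure properties read like continuity rules; loop
  bodies are handled by extending the index with the loop variables.
\<close>

definition ptime :: "'a set \<Rightarrow> ('a \<Rightarrow> tree) \<Rightarrow> ('a \<Rightarrow> tree) \<Rightarrow> bool" where
  "ptime D e g \<longleftrightarrow> (\<exists>P T. (\<forall>a \<in> D. run P (e a) (g a) (T a)) \<and> pbound D e T)"

section \<open>Closure properties of polynomial bounds\<close>

lemma poly_nat_mono: "x \<le> y \<Longrightarrow> poly (q :: nat poly) x \<le> poly q y"
  by (induct q) (auto intro!: add_mono mult_mono)

lemma pbound_mono: "pbound D e C \<Longrightarrow> (\<And>a. a \<in> D \<Longrightarrow> B a \<le> C a) \<Longrightarrow> pbound D e B"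
  unfolding pbound_def by (meson order_trans)

lemma pbound_const: "pbound D e (\<lambda>_. k)"
  unfolding pbound_def by (rule exI[of _ "[:k:]"]) simp

lemma pbound_size: "pbound D e (\<lambda>a. tsize (e a))"
  unfolding pbound_def by (rule exI[of _ "[:0, 1:]"]) simp

lemma pbound_add:
  assumes "pbound D e B" "pbound D e C"
  shows "pbound D e (\<lambda>a. B a + C a)"
proof -
  from assms obtain p q where "\<forall>a \<in> D. B a \<le> poly p (tsize (e a))" "\<forall>a \<in> D. C a \<le> poly q (tsize (e a))"
    unfolding pbound_def by blast
  then show ?thesis
    unfolding pbound_def by (intro exI[of _ "p + q"]) (auto intro: add_mono)
qed

lemma pbound_mult:
  assumes "pbound D e B" "pbound D e C"
  shows "pbound D e (\<lambda>a. B a * C a)"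
proof -
  from assms obtain p q where "\<forall>a \<in> D. B a \<le> poly p (tsize (e a))" "\<forall>a \<in> D. C a \<le> poly q (tsize (e a))"
    unfolding pbound_def by blast
  then show ?thesis
    unfolding pbound_def by (intro exI[of _ "p * q"]) (auto intro: mult_le_mono)
qed

lemma pbound_poly:
  assumes "pbound D e B"
  shows "pbound D e (\<lambda>a. poly q (B a))"
proof -
  from assms obtain p where "\<forall>a \<in> D. B a \<le> poly p (tsize (e a))"
    unfolding pbound_def by blast
  then show ?thesis
    unfolding pbound_def by (intro exI[of _ "pcompose q p"]) (auto simp: poly_pcompose intro: poly_nat_mono)
qed

text \<open>Polynomials compose: \<open>B\<close> is polynomial in the size of an intermediate
  result, and that size is polynomial in the size of the input.\<close>

lemma pbound_comp:
  assumes "pbound E g B" "pbound D e (\<lambda>a. tsize (g (\<phi> a)))" "\<And>a. a \<in> D \<Longrightarrow> \<phi> a \<in> E"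
  shows "pbound D e (\<lambda>a. B (\<phi> a))"
proof -
  from assms(1) obtain q where "\<forall>a \<in> E. B a \<le> poly q (tsize (g a))"
    unfolding pbound_def by blast
  then show ?thesis
    using assms(3) by (intro pbound_mono[OF pbound_poly[OF assms(2), of q]]) auto
qed

section \<open>Composition of polynomial-time functions\<close>

lemma ptime_run: "(\<And>a. a \<in> D \<Longrightarrow> run P (e a) (g a) (T a)) \<Longrightarrow> pbound D e T \<Longrightarrow> ptime D e g"
  unfolding ptime_def by (rule exI[of _ P], rule exI[of _ T]) simp

lemma ptimeI:
  assumes "\<And>a. a \<in> D \<Longrightarrow> \<exists>t. run P (e a) (g a) t \<and> t \<le> B a" "pbound D e B"
  shows "ptime D e g"
proof -
  from assms(1) obtain T where "\<forall>a \<in> D. run P (e a) (g a) (T a) \<and> T a \<le> B a"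
    by metis
  then show ?thesis
    by (intro ptime_run[of D P e g T] pbound_mono[OF assms(2)]) simp_all
qed

text \<open>Hides the time function behind one polynomial, the form needed for a loop body, whose
  running time is estimated from the size of the current state.\<close>

lemma ptime_polyD:
  assumes "ptime D e g"
  shows "\<exists>P q. \<forall>a \<in> D. \<exists>t. run P (e a) (g a) t \<and> t \<le> poly q (tsize (e a))"
proof -
  from assms obtain P T q where "\<forall>a \<in> D. run P (e a) (g a) (T a)" "\<forall>a \<in> D. T a \<le> poly q (tsize (e a))"
    by (auto simp: ptime_def pbound_def)
  then show ?thesis
    by (intro exI[of _ P] exI[of _ q]) auto
qed

text \<open>Writing an output costs at least its size. Hence every \<open>ptime\<close> fact also
  yields the size bound under which its result can be passed on.\<close>

lemma ptime_pbound:
  assumes "ptime D e g"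
  shows "pbound D e (\<lambda>a. tsize (g a))"
proof -
  from assms obtain P T where P: "\<forall>a \<in> D. run P (e a) (g a) (T a)" and T: "pbound D e T"
    by (auto simp: ptime_def)
  show ?thesis
    using T
  proof (rule pbound_mono)
    fix a assume "a \<in> D"
    with P have "run P (e a) (g a) (T a)" by simp
    from size_le_time[OF this] show "tsize (g a) \<le> T a" by simp
  qed
qed

lemma ptime_cong: "ptime D e f \<Longrightarrow> (\<And>a. a \<in> D \<Longrightarrow> g a = f a) \<Longrightarrow> ptime D e g"
  unfolding ptime_def by (simp cong: ball_cong)

lemma ptime_prim:
  assumes "pbound D e (\<lambda>a. tsize (prim_fun p (e a)))"
  shows "ptime D e (\<lambda>a. prim_fun p (e a))"
  using run_Prim pbound_add[OF pbound_size assms] by (rule ptime_run)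

text \<open>The subroutine call: \<open>\<phi>\<close> translates the indices of the caller into
  those over which the called program was analysed. Its time is polynomial in the input because the
  intermediate tree is polynomially large.\<close>

lemma ptime_comp:
  assumes "ptime D e (\<lambda>a. g (\<phi> a))" "ptime E g h" "\<And>a. a \<in> D \<Longrightarrow> \<phi> a \<in> E"
  shows "ptime D e (\<lambda>a. h (\<phi> a))"
proof -
  from assms(1) obtain P S where P: "\<forall>a \<in> D. run P (e a) (g (\<phi> a)) (S a)" "pbound D e S"
    by (auto simp: ptime_def)
  from assms(2) obtain Q T where Q: "\<forall>a \<in> E. run Q (g a) (h a) (T a)" "pbound E g T"
    by (auto simp: ptime_def)
  have "pbound D e (\<lambda>a. S a + T (\<phi> a))"
    by (intro pbound_add P pbound_comp[OF Q(2)] ptime_pbound assms)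
  with _ show ?thesis
    by (rule ptime_run) (use P Q assms(3) in \<open>blast intro: run_Seq\<close>)
qed

lemma ptime_trans: "ptime D e g \<Longrightarrow> ptime D g h \<Longrightarrow> ptime D e h"
  using ptime_comp[of D e g "\<lambda>a. a" D h] by simp

lemma ptime_id: "ptime D e e"
  using ptime_prim[of D e Ident] by (simp add: pbound_size)

lemma ptime_const: "ptime D e (\<lambda>_. c)"
  using ptime_prim[of D e "Const c"] by (simp add: pbound_const)

lemma ptime_Node:
  assumes "ptime D e f" "ptime D e g"
  shows "ptime D e (\<lambda>a. Node (f a) (g a))"
proof -
  from assms(1) obtain P S where P: "\<forall>a \<in> D. run P (e a) (f a) (S a)" "pbound D e S"
    by (auto simp: ptime_def)
  from assms(2) obtain Q T where Q: "\<forall>a \<in> D. run Q (e a) (g a) (T a)" "pbound D e T"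
    by (auto simp: ptime_def)
  have "pbound D e (\<lambda>a. S a + T a + 1)"
    by (intro pbound_add P Q pbound_const)
  with _ show ?thesis
    by (rule ptime_run) (use P Q in \<open>blast intro: run_Fork\<close>)
qed

lemma ptime_NodeL:
  assumes "ptime D f h"
  shows "ptime D (\<lambda>a. Node (f a) (g a)) h"
proof -
  have "ptime D (\<lambda>a. Node (f a) (g a)) f"
    by (rule ptime_cong[OF ptime_prim[where p = Fst]], rule pbound_mono[OF pbound_size]) simp_all
  then show ?thesis
    using assms by (rule ptime_trans)
qed

lemma ptime_NodeR:
  assumes "ptime D g h"
  shows "ptime D (\<lambda>a. Node (f a) (g a)) h"
proof -
  have "ptime D (\<lambda>a. Node (f a) (g a)) g"
    by (rule ptime_cong[OF ptime_prim[where p = Snd]], rule pbound_mono[OF pbound_size]) simp_all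
  then show ?thesis
    using assms by (rule ptime_trans)
qed

lemma ptime_fst: "ptime D e (\<lambda>a. Node (f a) (g a)) \<Longrightarrow> ptime D e f"
  by (erule ptime_trans) (intro ptime_NodeL ptime_id)

lemma ptime_snd: "ptime D e (\<lambda>a. Node (f a) (g a)) \<Longrightarrow> ptime D e g"
  by (erule ptime_trans) (intro ptime_NodeR ptime_id)

section \<open>Integer arithmetic and case distinction\<close>

lemma less_power_bitlen: "\<bar>x\<bar> < 2 ^ nat (bitlen \<bar>x\<bar>)"
  using bitlen_le_iff_power[of "\<bar>x\<bar>" "nat (bitlen \<bar>x\<bar>)"] by (simp add: bitlen_nonneg)

lemma tsize_Leaf_le_iff: "tsize (Leaf x) \<le> 1 + k \<longleftrightarrow> \<bar>x\<bar> < 2 ^ k"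
  using bitlen_le_iff_power[of "\<bar>x\<bar>" k] by auto

lemma tsize_Leaf_mono: "\<bar>x\<bar> \<le> \<bar>y\<bar> \<Longrightarrow> tsize (Leaf x) \<le> tsize (Leaf y)"
  using tsize_Leaf_le_iff[of x "nat (bitlen \<bar>y\<bar>)"] less_power_bitlen[of y] by simp

lemma tsize_Leaf_add: "tsize (Leaf (x + y)) \<le> tsize (Leaf x) + tsize (Leaf y)"
proof -
  define k l where "k = nat (bitlen \<bar>x\<bar>)" and "l = nat (bitlen \<bar>y\<bar>)"
  have k: "\<bar>x\<bar> < 2 ^ k" and l: "\<bar>y\<bar> < 2 ^ l"
    unfolding k_def l_def by (rule less_power_bitlen)+
  have "(2::int) ^ k \<le> 2 ^ (k + l)" "(2::int) ^ l \<le> 2 ^ (k + l)"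
    by simp_all
  moreover have "(2::int) ^ (k + l + 1) = 2 * 2 ^ (k + l)"
    by simp
  \<comment> \<open>The carry bit is paid for by the constant of the second leaf:
    \<open>1 + (k + l + 1) = (1 + k) + (1 + l)\<close>.\<close>
  ultimately have "\<bar>x + y\<bar> < 2 ^ (k + l + 1)"
    using k l abs_triangle_ineq[of x y] by linarith
  then show ?thesis
    using tsize_Leaf_le_iff[of "x + y" "k + l + 1"] by (simp add: k_def l_def)
qed

lemma tsize_Leaf_mult: "tsize (Leaf (x * y)) \<le> tsize (Leaf x) + tsize (Leaf y)"
proof -
  define k l where "k = nat (bitlen \<bar>x\<bar>)" and "l = nat (bitlen \<bar>y\<bar>)"
  have k: "\<bar>x\<bar> < 2 ^ k" and l: "\<bar>y\<bar> < 2 ^ l"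
    unfolding k_def l_def by (rule less_power_bitlen)+
  then have "\<bar>x * y\<bar> < 2 ^ (k + l)"
    by (simp add: abs_mult power_add mult_strict_mono')
  then show ?thesis
    using tsize_Leaf_le_iff[of "x * y" "k + l"] by (simp add: k_def l_def)
qed

text \<open>\<open>div\<close> rounds down, so for a positive divisor the quotient lies between the
  dividend and 0, or between the dividend and -1 if that is negative. A negative divisor is treated
  by negating both arguments.\<close>

lemma abs_div_le: "\<bar>x div y\<bar> \<le> \<bar>x :: int\<bar>"
proof (cases "y = 0")
  case False
  have nonneg: "\<bar>u div w\<bar> \<le> \<bar>u\<bar>" if "w > 0" for u w :: int
  proof (cases "u \<ge> 0")
    case True
    then show ?thesis
      using that zdiv_mono2[of u 1 w] by (simp add: pos_imp_zdiv_nonneg_iff)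
  next
    case False
    then have "u div w < 0" "u div 1 \<le> u div w"
      using that zdiv_mono2_neg[of u 1 w] by (auto simp: pos_imp_zdiv_neg_iff)
    then show ?thesis by simp
  qed
  from False nonneg[of y x] nonneg[of "- y" "- x"] show ?thesis
    by (cases "y > 0") auto
qed simp

lemma tsize_Leaf_div: "tsize (Leaf (x div y)) \<le> tsize (Leaf x) + 1"
  by (rule trans_le_add1[OF tsize_Leaf_mono[OF abs_div_le]])

text \<open>The size hypothesis says that the result is no larger than the node holding both
  arguments; this node is the source of the \<open>+ 1\<close>.\<close>

lemma ptime_arith:
  assumes "\<And>v. prim_fun p v = arith op v"
    and "\<And>x y. tsize (Leaf (op x y)) \<le> tsize (Leaf x) + tsize (Leaf y) + 1"
    and "ptime D e (\<lambda>a. Leaf (x a))" "ptime D e (\<lambda>a. Leaf (y a))"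
  shows "ptime D e (\<lambda>a. Leaf (op (x a) (y a)))"
proof -
  let ?g = "\<lambda>a. Node (Leaf (x a)) (Leaf (y a))"
  have "pbound D ?g (\<lambda>a. tsize (prim_fun p (?g a)))"
    by (rule pbound_mono[OF pbound_size]) (use assms(2) in \<open>auto simp: assms(1) simp del: tsize.simps(1)\<close>)
  from ptime_prim[OF this] have "ptime D ?g (\<lambda>a. Leaf (op (x a) (y a)))"
    by (simp add: assms(1))
  then show ?thesis
    by (rule ptime_trans[OF ptime_Node[OF assms(3,4)]])
qed

lemma ptime_add:
  "ptime D e (\<lambda>a. Leaf (x a)) \<Longrightarrow> ptime D e (\<lambda>a. Leaf (y a)) \<Longrightarrow> ptime D e (\<lambda>a. Leaf (x a + y a))"
  by (rule ptime_arith[where p = Add]) (simp_all only: prim_fun.simps trans_le_add1[OF tsize_Leaf_add])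

lemma ptime_mult:
  "ptime D e (\<lambda>a. Leaf (x a)) \<Longrightarrow> ptime D e (\<lambda>a. Leaf (y a)) \<Longrightarrow> ptime D e (\<lambda>a. Leaf (x a * y a))"
  by (rule ptime_arith[where p = Mul]) (simp_all only: prim_fun.simps trans_le_add1[OF tsize_Leaf_mult])

text \<open>The difference is computed as \<open>x + (-1) * y\<close>, which reuses the size bounds
  of sums and products.\<close>

lemma ptime_diff:
  assumes "ptime D e (\<lambda>a. Leaf (x a))" "ptime D e (\<lambda>a. Leaf (y a))"
  shows "ptime D e (\<lambda>a. Leaf (x a - y a))"
  using ptime_add[OF assms(1) ptime_mult[OF ptime_const assms(2)], of "-1"] by simp

lemma ptime_div:
  "ptime D e (\<lambda>a. Leaf (x a)) \<Longrightarrow> ptime D e (\<lambda>a. Leaf (y a)) \<Longrightarrow> ptime D e (\<lambda>a. Leaf (x a div y a))"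
  by (rule ptime_arith[where p = Div, OF _ order_trans[OF tsize_Leaf_div]]) simp_all

lemma ptime_le:
  "ptime D e (\<lambda>a. Leaf (x a)) \<Longrightarrow> ptime D e (\<lambda>a. Leaf (y a)) \<Longrightarrow>
    ptime D e (\<lambda>a. Leaf (of_bool (x a \<le> y a)))"
  by (rule ptime_arith[where p = Leq and op = "\<lambda>x y. of_bool (x \<le> y)"])
    (auto simp: compute_bitlen[of 1])

lemma ptime_if:
  assumes "ptime D e (\<lambda>a. Leaf (of_bool (p a)))" "ptime D e f" "ptime D e g"
  shows "ptime D e (\<lambda>a. if p a then f a else g a)"
proof -
  from assms(1) obtain B R where B: "\<forall>a \<in> D. run B (e a) (Leaf (of_bool (p a))) (R a)" "pbound D e R"
    by (auto simp: ptime_def)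
  from assms(2) obtain P S where P: "\<forall>a \<in> D. run P (e a) (f a) (S a)" "pbound D e S"
    by (auto simp: ptime_def)
  from assms(3) obtain Q T where Q: "\<forall>a \<in> D. run Q (e a) (g a) (T a)" "pbound D e T"
    by (auto simp: ptime_def)
  show ?thesis
  proof (rule ptimeI)
    show "pbound D e (\<lambda>a. R a + S a + T a)"
      by (intro pbound_add B P Q)
  next
    fix a assume a: "a \<in> D"
    show "\<exists>t. run (Cond B P Q) (e a) (if p a then f a else g a) t \<and> t \<le> R a + S a + T a"
    proof (cases "p a")
      case True
      then have "run (Cond B P Q) (e a) (f a) (R a + S a)"
        using a B P by (intro run_Cond_True[of _ _ "Leaf 1"]) force+
      with True show ?thesis by force
    next
      case False
      then have "run (Cond B P Q) (e a) (g a) (R a + T a)"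
        using a B Q by (intro run_Cond_False) force+
      with False show ?thesis by force
    qed
  qed
qed

lemma ptime_max:
  assumes "ptime D e (\<lambda>a. Leaf (x a))" "ptime D e (\<lambda>a. Leaf (y a))"
  shows "ptime D e (\<lambda>a. Leaf (max (x a) (y a)))"
  by (rule ptime_cong[OF ptime_if[OF ptime_le[OF assms] assms(2) assms(1)]]) (simp add: max_def)

text \<open>The rule for loops with \<open>N a\<close> rounds. Body and test see only the tree
  \<open>st a k\<close>, so the test has to recognise the last round from the state. The bound
  \<open>B\<close> on all states is a separate hypothesis: a polynomial-time body could double the
  state in every round.\<close>

lemma ptime_iterate:
  fixes st :: "'a \<Rightarrow> nat \<Rightarrow> tree"
  assumes init: "ptime D e (\<lambda>a. st a 0)"
    and step: "ptime {p. fst p \<in> D \<and> snd p < N (fst p)}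
      (\<lambda>p. st (fst p) (snd p)) (\<lambda>p. st (fst p) (Suc (snd p)))"
    and test: "ptime {p. fst p \<in> D \<and> snd p \<le> N (fst p)}
      (\<lambda>p. st (fst p) (snd p)) (\<lambda>p. Leaf (of_bool (snd p < N (fst p))))"
    and iterations: "pbound D e N"
    and bound: "pbound D e B" "\<And>a k. a \<in> D \<Longrightarrow> k \<le> N a \<Longrightarrow> tsize (st a k) \<le> B a"
  shows "ptime D e (\<lambda>a. st a (N a))"
proof -
  from init obtain P S where P: "\<forall>a \<in> D. run P (e a) (st a 0) (S a)" "pbound D e S"
    by (auto simp: ptime_def)
  from ptime_polyD[OF step] obtain Q q where Q: "\<forall>p \<in> {p. fst p \<in> D \<and> snd p < N (fst p)}.
      \<exists>t. run Q (st (fst p) (snd p)) (st (fst p) (Suc (snd p))) t \<and>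
        t \<le> poly q (tsize (st (fst p) (snd p)))"
    by (elim exE)
  from ptime_polyD[OF test] obtain R r where R: "\<forall>p \<in> {p. fst p \<in> D \<and> snd p \<le> N (fst p)}.
      \<exists>t. run R (st (fst p) (snd p)) (Leaf (of_bool (snd p < N (fst p)))) t \<and>
        t \<le> poly r (tsize (st (fst p) (snd p)))"
    by (elim exE)
  \<comment> \<open>\<open>C a\<close> pays for one evaluation of the test and one of the body on
    any state of size at most \<open>B a\<close>.\<close>
  define C where "C a = poly q (B a) + poly r (B a)" for a
  \<comment> \<open>Induction on the number \<open>m\<close> of remaining rounds, since runs of a
    loop are built from the end. The summands after \<open>m * C a\<close> pay for the failing last
    test and the charge for returning the state.\<close>
  have loop: "\<exists>t. run (While R Q) (st a (N a - m)) (st a (N a)) t \<and> t \<le> m * C a + C a + B a"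
    if a: "a \<in> D" and "m \<le> N a" for a m
    using \<open>m \<le> N a\<close>
  proof (induction m)
    case 0
    obtain t where "run R (st a (N a)) (Leaf 0) t" "t \<le> poly r (tsize (st a (N a)))"
      using R[rule_format, of "(a, N a)"] a by auto
    moreover have "poly r (tsize (st a (N a))) \<le> C a"
      unfolding C_def using poly_nat_mono[OF bound(2)[OF a order_refl], of r] by simp
    ultimately show ?case
      using run_While_False[of R "st a (N a)" t Q] bound(2)[OF a order_refl] by fastforce
  next
    case (Suc m)
    then obtain t where t: "run (While R Q) (st a (N a - m)) (st a (N a)) t" "t \<le> m * C a + C a + B a"
      by auto
    let ?k = "N a - Suc m"
    have k: "?k < N a" "Suc ?k = N a - m"
      using Suc.prems by auto
    obtain u where u: "run R (st a ?k) (Leaf 1) u" "u \<le> poly r (tsize (st a ?k))"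
      using R[rule_format, of "(a, ?k)"] a k(1) by auto
    obtain v where v: "run Q (st a ?k) (st a (N a - m)) v" "v \<le> poly q (tsize (st a ?k))"
      using Q[rule_format, of "(a, ?k)"] a k by auto
    have "tsize (st a ?k) \<le> B a"
      using bound(2)[OF a] k(1) by simp
    then have "u + v \<le> C a"
      unfolding C_def using poly_nat_mono[of "tsize (st a ?k)" "B a" q]
        poly_nat_mono[of "tsize (st a ?k)" "B a" r] u(2) v(2)
      by linarith
    moreover have "run (While R Q) (st a ?k) (st a (N a)) (u + v + t)"
      by (rule run_While_True[OF u(1) _ v(1) t(1)]) simp
    ultimately show ?case
      using t(2) by (intro exI[of _ "u + v + t"]) simp
  qed
  show ?thesis
  proof (rule ptimeI)
    show "pbound D e (\<lambda>a. S a + (N a * C a + C a + B a))"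
      unfolding C_def by (intro pbound_add pbound_mult pbound_poly P iterations bound)
  next
    fix a assume a: "a \<in> D"
    from loop[OF a order_refl] obtain t where "run (While R Q) (st a 0) (st a (N a)) t"
      "t \<le> N a * C a + C a + B a"
      by auto
    then show "\<exists>t. run (Seq P (While R Q)) (e a) (st a (N a)) t \<and> t \<le> S a + (N a * C a + C a + B a)"
      using P(1) a run_Seq by (meson add_left_mono)
  qed
qed

section \<open>Environments and lists\<close>

lemmas ptime_L = ptime_NodeL[OF ptime_id]
lemmas ptime_R = ptime_NodeR[OF ptime_id]
lemmas ptime_RL = ptime_NodeR[OF ptime_L]
lemmas ptime_RR = ptime_NodeR[OF ptime_R]

text \<open>Makes facts established outside a loop usable in its body: \<open>\<pi>\<close> forgets
  the loop variables, and the old environment is recovered from the extended one.\<close>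

lemma ptime_env:
  assumes "ptime D e f" "ptime E e' (\<lambda>p. e (\<pi> p))" "\<And>p. p \<in> E \<Longrightarrow> \<pi> p \<in> D"
  shows "ptime E e' (\<lambda>p. f (\<pi> p))"
  using assms(2,1,3) by (rule ptime_comp)

lemma ptime_IsNode:
  assumes "ptime D e (\<lambda>a. enc_list h (l a))"
  shows "ptime D e (\<lambda>a. Leaf (of_bool (l a \<noteq> [])))"
proof -
  let ?e = "\<lambda>a. enc_list h (l a)"
  have *: "prim_fun IsNode (?e a) = Leaf (of_bool (l a \<noteq> []))" for a
    by (cases "l a") auto
  have "pbound D ?e (\<lambda>a. tsize (prim_fun IsNode (?e a)))"
    unfolding * by (rule pbound_mono[OF pbound_const[of _ _ 2]]) (simp add: compute_bitlen[of 1])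
  from ptime_prim[OF this] show ?thesis
    unfolding * by (rule ptime_trans[OF assms])
qed

text \<open>The encoding of a nonempty list is already the pair of its encoded head and
  tail.\<close>

lemma ptime_hd_tl:
  assumes "ptime D e (\<lambda>a. enc_list h (l a))" "\<And>a. a \<in> D \<Longrightarrow> l a \<noteq> []"
  shows ptime_hd: "ptime D e (\<lambda>a. h (hd (l a)))"
    and ptime_tl: "ptime D e (\<lambda>a. enc_list h (tl (l a)))"
proof -
  have *: "ptime D e (\<lambda>a. Node (h (hd (l a))) (enc_list h (tl (l a))))"
  proof (rule ptime_cong[OF assms(1)])
    fix a assume "a \<in> D"
    with assms(2)[of a] show "Node (h (hd (l a))) (enc_list h (tl (l a))) = enc_list h (l a)"
      by (cases "l a") auto
  qed
  show "ptime D e (\<lambda>a. h (hd (l a)))" "ptime D e (\<lambda>a. enc_list h (tl (l a)))"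
    by (rule ptime_fst[OF *], rule ptime_snd[OF *])
qed

lemma ptime_Cons:
  assumes "ptime D e (\<lambda>a. h (x a))" "ptime D e (\<lambda>a. enc_list h (l a))"
  shows "ptime D e (\<lambda>a. enc_list h (x a # l a))"
  using ptime_Node[OF assms] by simp

lemma ptime_Nil: "ptime D e (\<lambda>_. enc_list h [])"
  by (rule ptime_const)

lemma tsize_enc_list: "tsize (enc_list h l) = Suc (\<Sum>x\<leftarrow>l. Suc (tsize (h x)))"
  by (induct l) auto

lemma length_le_tsize: "length l \<le> tsize (enc_list h l)"
  by (induct l) auto

lemma tsize_member_le: "x \<in> set l \<Longrightarrow> tsize (h x) \<le> tsize (enc_list h l)"
  by (induct l) auto

lemma tsize_drop_le: "tsize (enc_list h (drop k l)) \<le> tsize (enc_list h l)"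
proof (induct l arbitrary: k)
  case (Cons x l)
  then show ?case
    by (cases k) (auto simp: le_SucI trans_le_add2)
qed simp

text \<open>\<open>Inv\<close> restricts the accumulators on which the body has to be correct.
  Growth by at most an additive \<open>B a\<close> per element keeps the accumulator polynomially
  large.\<close>

lemma ptime_foldl:
  fixes f :: "'a \<Rightarrow> 's \<Rightarrow> 'x \<Rightarrow> 's"
  assumes list: "ptime D e (\<lambda>a. enc_list h (l a))"
    and init: "ptime D e (\<lambda>a. s (z a))"
    and step: "ptime {p. fst p \<in> D \<and> Inv (fst p) (fst (snd p)) \<and> snd (snd p) \<in> set (l (fst p))}
      (\<lambda>p. Node (e (fst p)) (Node (s (fst (snd p))) (h (snd (snd p)))))
      (\<lambda>p. s (f (fst p) (fst (snd p)) (snd (snd p))))"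
    and Inv: "\<And>a. a \<in> D \<Longrightarrow> Inv a (z a)"
      "\<And>a \<sigma> x. a \<in> D \<Longrightarrow> Inv a \<sigma> \<Longrightarrow> x \<in> set (l a) \<Longrightarrow> Inv a (f a \<sigma> x)"
    and growth: "pbound D e B"
      "\<And>a \<sigma> x. a \<in> D \<Longrightarrow> Inv a \<sigma> \<Longrightarrow> x \<in> set (l a) \<Longrightarrow> tsize (s (f a \<sigma> x)) \<le> tsize (s \<sigma>) + B a"
  shows "ptime D e (\<lambda>a. s (foldl (f a) (z a) (l a)))"
proof -
  define \<sigma> where "\<sigma> a k = foldl (f a) (z a) (take k (l a))" for a k
  \<comment> \<open>The loop state holds the environment, the accumulator and the unread suffix. The
    loop ends when the suffix is the leaf of the empty list.\<close>
  define st where "st a k = Node (e a) (Node (s (\<sigma> a k)) (enc_list h (drop k (l a))))" for a k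
  have \<sigma>_Suc: "\<sigma> a (Suc k) = f a (\<sigma> a k) (l a ! k)" if "k < length (l a)" for a k
    using that by (simp add: \<sigma>_def take_Suc_conv_app_nth)
  have \<sigma>: "Inv a (\<sigma> a k) \<and> tsize (s (\<sigma> a k)) \<le> tsize (s (z a)) + k * B a"
    if a: "a \<in> D" and "k \<le> length (l a)" for a k
    using that(2)
  proof (induction k)
    case 0
    then show ?case using Inv(1)[OF a] by (simp add: \<sigma>_def)
  next
    case (Suc k)
    then have "l a ! k \<in> set (l a)" "Inv a (\<sigma> a k)" "tsize (s (\<sigma> a k)) \<le> tsize (s (z a)) + k * B a"
      by auto
    with Inv(2)[OF a] growth(2)[OF a] \<sigma>_Suc[of k a] Suc.prems show ?case
      by fastforce
  qed
  have "ptime D e (\<lambda>a. st a (length (l a)))"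
  proof (rule ptime_iterate)
    show "ptime D e (\<lambda>a. st a 0)"
      unfolding st_def \<sigma>_def using list init by (auto intro!: ptime_Node ptime_id)
  next
    let ?E = "{p. fst p \<in> D \<and> snd p < length (l (fst p))}"
    let ?e = "\<lambda>p. st (fst p) (snd p)"
    have env: "ptime ?E ?e (\<lambda>p. e (fst p))" and state: "ptime ?E ?e (\<lambda>p. s (\<sigma> (fst p) (snd p)))"
      and rest: "ptime ?E ?e (\<lambda>p. enc_list h (drop (snd p) (l (fst p))))"
      unfolding st_def by (rule ptime_L ptime_RL ptime_RR)+
    have hd: "ptime ?E ?e (\<lambda>p. h (l (fst p) ! snd p))"
      by (rule ptime_cong[OF ptime_hd[OF rest]]) (auto simp: hd_drop_conv_nth)
    have tl: "ptime ?E ?e (\<lambda>p. enc_list h (drop (Suc (snd p)) (l (fst p))))"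
      by (rule ptime_cong[OF ptime_tl[OF rest]]) (auto simp: drop_Suc tl_drop)
    have "ptime ?E ?e (\<lambda>p. s (f (fst p) (\<sigma> (fst p) (snd p)) (l (fst p) ! snd p)))"
      using ptime_env[OF step, of ?E ?e "\<lambda>p. (fst p, \<sigma> (fst p) (snd p), l (fst p) ! snd p)"]
        ptime_Node[OF env ptime_Node[OF state hd]] \<sigma> by auto
    then have "ptime ?E ?e (\<lambda>p. s (\<sigma> (fst p) (Suc (snd p))))"
      by (rule ptime_cong) (simp add: \<sigma>_Suc)
    with env tl show "ptime ?E ?e (\<lambda>p. st (fst p) (Suc (snd p)))"
      unfolding st_def[of _ "Suc _"] by (intro ptime_Node)
  next
    let ?E = "{p. fst p \<in> D \<and> snd p \<le> length (l (fst p))}"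
    have "ptime ?E (\<lambda>p. st (fst p) (snd p)) (\<lambda>p. enc_list h (drop (snd p) (l (fst p))))"
      unfolding st_def by (rule ptime_RR)
    from ptime_IsNode[OF this]
    show "ptime ?E (\<lambda>p. st (fst p) (snd p)) (\<lambda>p. Leaf (of_bool (snd p < length (l (fst p)))))"
      by (simp add: not_le)
  next
    show "pbound D e (\<lambda>a. length (l a))"
      by (rule pbound_mono[OF ptime_pbound[OF list] length_le_tsize])
  next
    show "pbound D e (\<lambda>a. tsize (e a) +
        ((tsize (s (z a)) + tsize (enc_list h (l a)) * B a) + tsize (enc_list h (l a))) + 2)"
      by (intro pbound_add pbound_mult pbound_const pbound_size ptime_pbound[OF list]
          ptime_pbound[OF init] growth(1))
  next
    fix a k assume a: "a \<in> D" and k: "k \<le> length (l a)"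
    have "k * B a \<le> tsize (enc_list h (l a)) * B a"
      using k length_le_tsize[of "l a" h] by (intro mult_le_mono1) simp
    with \<sigma>[OF a k] tsize_drop_le[of h k "l a"]
    show "tsize (st a k) \<le> tsize (e a) +
        ((tsize (s (z a)) + tsize (enc_list h (l a)) * B a) + tsize (enc_list h (l a))) + 2"
      unfolding st_def tsize.simps(2) by linarith
  qed
  then have "ptime D e (\<lambda>a. Node (e a) (Node (s (\<sigma> a (length (l a)))) (enc_list h (drop (length (l a)) (l a)))))"
    unfolding st_def .
  from ptime_fst[OF ptime_snd[OF this]] show ?thesis
    by (simp add: \<sigma>_def)
qed

lemma foldl_Cons: "foldl (\<lambda>acc x. f x # acc) acc l = rev (map f l) @ acc"
  by (induct l arbitrary: acc) auto

lemma ptime_rev: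
  assumes "ptime D e (\<lambda>a. enc_list h (l a))"
  shows "ptime D e (\<lambda>a. enc_list h (rev (l a)))"
proof -
  have "ptime D e (\<lambda>a. enc_list h (foldl (\<lambda>acc x. x # acc) [] (l a)))"
  proof (rule ptime_foldl[where Inv = "\<lambda>_ _. True" and z = "\<lambda>_. []" and s = "enc_list h", OF assms ptime_Nil])
    show "ptime {p. fst p \<in> D \<and> True \<and> snd (snd p) \<in> set (l (fst p))}
        (\<lambda>p. Node (e (fst p)) (Node (enc_list h (fst (snd p))) (h (snd (snd p)))))
        (\<lambda>p. enc_list h (snd (snd p) # fst (snd p)))"
      by (rule ptime_Cons, rule ptime_RR, rule ptime_RL)
  next
    show "pbound D e (\<lambda>a. tsize (enc_list h (l a)) + 1)"
      by (intro pbound_add pbound_const ptime_pbound assms)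
  qed (auto dest: tsize_member_le[of _ _ h])
  then show ?thesis
    by (simp add: foldl_Cons[of "\<lambda>x. x", simplified])
qed

text \<open>A left fold collects the images in reverse order, and \<open>ptime_rev\<close> restores
  it. The body receives the environment besides the element, so \<open>f\<close> may depend on
  \<open>a\<close>.\<close>

lemma ptime_map:
  assumes list: "ptime D e (\<lambda>a. enc_list h (l a))"
    and f: "ptime {p. fst p \<in> D \<and> snd p \<in> set (l (fst p))}
      (\<lambda>p. Node (e (fst p)) (h (snd p))) (\<lambda>p. k (f (fst p) (snd p)))"
  shows "ptime D e (\<lambda>a. enc_list k (map (f a) (l a)))"
proof -
  from ptime_pbound[OF f] obtain q where
    q: "\<And>a x. a \<in> D \<Longrightarrow> x \<in> set (l a) \<Longrightarrow> tsize (k (f a x)) \<le> poly q (tsize (e a) + tsize (h x) + 1)"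
    by (auto simp: pbound_def)
  have "ptime D e (\<lambda>a. enc_list k (foldl (\<lambda>acc x. f a x # acc) [] (l a)))"
  proof (rule ptime_foldl[where Inv = "\<lambda>_ _. True" and z = "\<lambda>_. []" and s = "enc_list k", OF list ptime_Nil])
    let ?E = "{p. fst p \<in> D \<and> True \<and> snd (snd p) \<in> set (l (fst p))}"
    let ?e = "\<lambda>p. Node (e (fst p)) (Node (enc_list k (fst (snd p))) (h (snd (snd p))))"
    have "ptime ?E ?e (\<lambda>p. Node (e (fst p)) (h (snd (snd p))))"
      by (rule ptime_Node, rule ptime_L, rule ptime_RR)
    then have "ptime ?E ?e (\<lambda>p. k (f (fst p) (snd (snd p))))"
      using ptime_env[OF f, of ?E ?e "\<lambda>p. (fst p, snd (snd p))"] by auto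
    moreover have "ptime ?E ?e (\<lambda>p. enc_list k (fst (snd p)))"
      by (rule ptime_RL)
    ultimately show "ptime ?E ?e (\<lambda>p. enc_list k (f (fst p) (snd (snd p)) # fst (snd p)))"
      by (rule ptime_Cons)
  next
    show "pbound D e (\<lambda>a. poly q (tsize (e a) + tsize (enc_list h (l a)) + 1) + 1)"
      by (intro pbound_add pbound_poly pbound_const pbound_size ptime_pbound list)
  next
    fix a \<sigma> x assume a: "a \<in> D" "x \<in> set (l a)"
    have "poly q (tsize (e a) + tsize (h x) + 1) \<le> poly q (tsize (e a) + tsize (enc_list h (l a)) + 1)"
      using tsize_member_le[OF a(2), of h] by (intro poly_nat_mono) simp
    with q[OF a] show "tsize (enc_list k (f a x # \<sigma>))
        \<le> tsize (enc_list k \<sigma>) + (poly q (tsize (e a) + tsize (enc_list h (l a)) + 1) + 1)"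
      by simp
  qed auto
  from ptime_rev[OF this] show ?thesis
    by (simp add: foldl_Cons)
qed

text \<open>Two lists are consumed in lockstep, hence the direct use of \<open>ptime_iterate\<close>
  instead of a fold over one list.\<close>

lemma ptime_zip:
  assumes l: "ptime D e (\<lambda>a. enc_list h (l a))" and m: "ptime D e (\<lambda>a. enc_list k (m a))"
    and len: "\<And>a. a \<in> D \<Longrightarrow> length (l a) = length (m a)"
  shows "ptime D e (\<lambda>a. enc_list (\<lambda>q. Node (h (fst q)) (k (snd q))) (zip (l a) (m a)))"
proof -
  let ?c = "\<lambda>q. Node (h (fst q)) (k (snd q))"
  define st where "st a j = Node (enc_list ?c (rev (take j (zip (l a) (m a)))))
      (Node (enc_list h (drop j (l a))) (enc_list k (drop j (m a))))" for a j
  \<comment> \<open>A pair in the accumulator costs a list node and a pair node, as much as the two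
    list nodes its entries occupied before. The 1 is the leaf that ends the accumulator.\<close>
  have size: "tsize (enc_list ?c (rev ps)) + tsize (enc_list h xs) + tsize (enc_list k ys)
      \<le> tsize (enc_list h (map fst ps @ xs)) + tsize (enc_list k (map snd ps @ ys)) + 1" for ps xs ys
    by (induct ps) (auto simp: tsize_enc_list)
  have "ptime D e (\<lambda>a. st a (length (l a)))"
  proof (rule ptime_iterate)
    show "ptime D e (\<lambda>a. st a 0)"
      unfolding st_def using l m by (auto intro!: ptime_Node ptime_const)
  next
    let ?E = "{p. fst p \<in> D \<and> snd p < length (l (fst p))}"
    let ?e = "\<lambda>p. st (fst p) (snd p)"
    have acc: "ptime ?E ?e (\<lambda>p. enc_list ?c (rev (take (snd p) (zip (l (fst p)) (m (fst p))))))"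
      unfolding st_def by (rule ptime_L)
    have l: "ptime ?E ?e (\<lambda>p. enc_list h (drop (snd p) (l (fst p))))"
      unfolding st_def by (rule ptime_RL)
    have m: "ptime ?E ?e (\<lambda>p. enc_list k (drop (snd p) (m (fst p))))"
      unfolding st_def by (rule ptime_RR)
    have "ptime ?E ?e (\<lambda>p. ?c (l (fst p) ! snd p, m (fst p) ! snd p))"
      using ptime_Node[OF ptime_hd[OF l] ptime_hd[OF m]]
      by (rule ptime_cong) (auto simp: hd_drop_conv_nth len)
    from ptime_Cons[where h = ?c, OF this acc]
    have "ptime ?E ?e (\<lambda>p. enc_list ?c (rev (take (Suc (snd p)) (zip (l (fst p)) (m (fst p))))))"
      by (rule ptime_cong) (auto simp: take_Suc_conv_app_nth len)
    moreover have "ptime ?E ?e (\<lambda>p. enc_list h (drop (Suc (snd p)) (l (fst p))))"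
      by (rule ptime_cong[OF ptime_tl[OF l]]) (auto simp: drop_Suc tl_drop)
    moreover have "ptime ?E ?e (\<lambda>p. enc_list k (drop (Suc (snd p)) (m (fst p))))"
      by (rule ptime_cong[OF ptime_tl[OF m]]) (auto simp: drop_Suc tl_drop len)
    ultimately show "ptime ?E ?e (\<lambda>p. st (fst p) (Suc (snd p)))"
      unfolding st_def[of _ "Suc _"] by (intro ptime_Node)
  next
    let ?E = "{p. fst p \<in> D \<and> snd p \<le> length (l (fst p))}"
    have "ptime ?E (\<lambda>p. st (fst p) (snd p)) (\<lambda>p. enc_list h (drop (snd p) (l (fst p))))"
      unfolding st_def by (rule ptime_RL)
    from ptime_IsNode[OF this]
    show "ptime ?E (\<lambda>p. st (fst p) (snd p)) (\<lambda>p. Leaf (of_bool (snd p < length (l (fst p)))))"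
      by (simp add: not_le)
  next
    show "pbound D e (\<lambda>a. length (l a))"
      by (rule pbound_mono[OF ptime_pbound[OF l] length_le_tsize])
  next
    show "pbound D e (\<lambda>a. tsize (enc_list h (l a)) + tsize (enc_list k (m a)) + 3)"
      by (intro pbound_add pbound_const ptime_pbound l m)
  next
    fix a j assume a: "a \<in> D" and j: "j \<le> length (l a)"
    have "map fst (take j (zip (l a) (m a))) @ drop j (l a) = l a"
      "map snd (take j (zip (l a) (m a))) @ drop j (m a) = m a"
      using len[OF a] by (simp_all add: take_zip)
    with size[of "take j (zip (l a) (m a))" "drop j (l a)" "drop j (m a)"]
    show "tsize (st a j) \<le> tsize (enc_list h (l a)) + tsize (enc_list k (m a)) + 3"
      by (simp add: st_def)
  qed
  then have "ptime D e (\<lambda>a. enc_list ?c (rev (take (length (l a)) (zip (l a) (m a)))))"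
    unfolding st_def by (rule ptime_fst)
  from ptime_rev[OF this] show ?thesis
    by (rule ptime_cong) (simp add: len)
qed

text \<open>Subadditive sizes give the additive growth that \<open>ptime_foldl\<close> asks for. The
  rule for \<open>op\<close> is required at the index type of the loop body, because a hypothesis
  cannot be polymorphic.\<close>

lemma ptime_foldl_int:
  fixes op :: "int \<Rightarrow> int \<Rightarrow> int" and D :: "'a set"
  assumes l: "ptime D e (\<lambda>a. enc_list Leaf (l a))" and z: "ptime D e (\<lambda>a. Leaf (z a))"
    and op: "\<And>(E :: ('a \<times> int \<times> int) set) e' x y. ptime E e' (\<lambda>a. Leaf (x a)) \<Longrightarrow> ptime E e' (\<lambda>a. Leaf (y a)) \<Longrightarrow>
      ptime E e' (\<lambda>a. Leaf (op (x a) (y a)))"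
    and size: "\<And>x y. tsize (Leaf (op x y)) \<le> tsize (Leaf x) + tsize (Leaf y)"
  shows "ptime D e (\<lambda>a. Leaf (foldl op (z a) (l a)))"
proof (rule ptime_foldl[where Inv = "\<lambda>_ _. True" and s = Leaf, OF l z])
  show "ptime {p. fst p \<in> D \<and> True \<and> snd (snd p) \<in> set (l (fst p))}
      (\<lambda>p. Node (e (fst p)) (Node (Leaf (fst (snd p))) (Leaf (snd (snd p)))))
      (\<lambda>p. Leaf (op (fst (snd p)) (snd (snd p))))"
    by (rule op, rule ptime_RL, rule ptime_RR)
next
  show "pbound D e (\<lambda>a. tsize (enc_list Leaf (l a)))"
    by (rule ptime_pbound[OF l])
next
  fix a \<sigma> x assume "x \<in> set (l a)"
  from tsize_member_le[OF this, of Leaf] size[of \<sigma> x]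
  show "tsize (Leaf (op \<sigma> x)) \<le> tsize (Leaf \<sigma>) + tsize (enc_list Leaf (l a))"
    by linarith
qed auto

lemma ptime_sum_list:
  assumes "ptime D e (\<lambda>a. enc_list Leaf (l a))"
  shows "ptime D e (\<lambda>a. Leaf (sum_list (l a)))"
proof -
  have "foldl (+) s xs = s + sum_list xs" for s :: int and xs
    by (induct xs arbitrary: s) auto
  with ptime_foldl_int[OF assms ptime_const[of _ _ "Leaf 0"] ptime_add tsize_Leaf_add]
  show ?thesis by simp
qed

lemma ptime_prod_list:
  assumes "ptime D e (\<lambda>a. enc_list Leaf (l a))"
  shows "ptime D e (\<lambda>a. Leaf (prod_list (l a)))"
proof -
  have "foldl (*) s xs = s * prod_list xs" for s :: int and xs
    by (induct xs arbitrary: s) auto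
  with ptime_foldl_int[OF assms ptime_const[of _ _ "Leaf 1"] ptime_mult tsize_Leaf_mult]
  show ?thesis by simp
qed

lemma ptime_Max:
  assumes "ptime D e (\<lambda>a. enc_list Leaf (l a))" "\<And>a. a \<in> D \<Longrightarrow> l a \<noteq> []"
  shows "ptime D e (\<lambda>a. Leaf (Max (set (l a))))"
proof -
  have "tsize (Leaf (max x y)) \<le> tsize (Leaf x) + tsize (Leaf y)" for x y
    by (simp add: max_def)
  from ptime_foldl_int[OF ptime_tl[OF assms] ptime_hd[OF assms] ptime_max this]
  show ?thesis
  proof (rule ptime_cong)
    fix a assume "a \<in> D"
    with assms(2) obtain x xs where "l a = x # xs"
      by (cases "l a") auto
    moreover have "(\<lambda>x s. max s x) = (max :: int \<Rightarrow> _)"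
      by (intro ext) (rule max.commute)
    ultimately show "Leaf (Max (set (l a))) = Leaf (foldl max (hd (l a)) (tl (l a)))"
      using Max.set_eq_fold[of x xs] by (simp add: foldl_conv_fold)
  qed
qed

section \<open>Integral instances\<close>

text \<open>This is the encoding of the rational number \<open>u\<close> with its reduced
  denominator 1, so integral instances are legal inputs of an algorithm for rational ones.\<close>

definition enc_int :: "int \<Rightarrow> tree" where
  "enc_int u = Node (Leaf u) (Leaf 1)"

definition enc_scenario :: "int list \<times> int \<Rightarrow> tree" where
  "enc_scenario cd = Node (enc_list enc_int (fst cd)) (enc_int (snd cd))"

definition enc_int_gen :: "bool list \<times> (int list \<times> int) list \<Rightarrow> tree" where
  "enc_int_gen i = Node (enc_bits (fst i)) (enc_list enc_scenario (snd i))"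

definition int_gen_instances ::
  "bool list set \<Rightarrow> (bool list \<Rightarrow> nat) \<Rightarrow> nat \<Rightarrow> (bool list \<times> (int list \<times> int) list) set" where
  "int_gen_instances inst n K =
    {i. fst i \<in> inst \<and> length (snd i) = K \<and> (\<forall>cd \<in> set (snd i). length (fst cd) = n (fst i))}"

definition dot :: "int list \<Rightarrow> int list \<Rightarrow> int" where
  "dot c x = sum_list (map (\<lambda>q. fst q * snd q) (zip c x))"

text \<open>The integral counterpart of \<open>gen_max_regret\<close>; the two are related by
  \<open>gen_obj_rat_gen\<close>.\<close>

definition gval :: "(int list \<times> int) list \<Rightarrow> int list \<Rightarrow> int" where
  "gval cds x = Max (set (map (\<lambda>cd. dot (fst cd) x - snd cd) cds))"

lemma ptime_enc_int: "ptime D e (\<lambda>a. Leaf (x a)) \<Longrightarrow> ptime D e (\<lambda>a. enc_int (x a))"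
  unfolding enc_int_def by (intro ptime_Node ptime_const)

lemma ptime_enc_intD: "ptime D e (\<lambda>a. enc_int (x a)) \<Longrightarrow> ptime D e (\<lambda>a. Leaf (x a))"
  unfolding enc_int_def by (rule ptime_fst)

lemma ptime_dot:
  assumes "ptime D e (\<lambda>a. enc_list enc_int (c a))" "ptime D e (\<lambda>a. enc_list Leaf (x a))"
    and "\<And>a. a \<in> D \<Longrightarrow> length (c a) = length (x a)"
  shows "ptime D e (\<lambda>a. Leaf (dot (c a) (x a)))"
  unfolding dot_def
proof (rule ptime_sum_list, rule ptime_map[OF ptime_zip[OF assms]])
  show "ptime {p. fst p \<in> D \<and> snd p \<in> set (zip (c (fst p)) (x (fst p)))}
     (\<lambda>p. Node (e (fst p)) (Node (enc_int (fst (snd p))) (Leaf (snd (snd p)))))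
     (\<lambda>p. Leaf (fst (snd p) * snd (snd p)))"
    by (rule ptime_mult, rule ptime_enc_intD, rule ptime_RL, rule ptime_RR)
qed

lemma ptime_gval:
  assumes cds: "ptime D e (\<lambda>a. enc_list enc_scenario (cds a))" and x: "ptime D e (\<lambda>a. enc_list Leaf (x a))"
    and len: "\<And>a cd. a \<in> D \<Longrightarrow> cd \<in> set (cds a) \<Longrightarrow> length (fst cd) = length (x a)"
    and ne: "\<And>a. a \<in> D \<Longrightarrow> cds a \<noteq> []"
  shows "ptime D e (\<lambda>a. Leaf (gval (cds a) (x a)))"
  unfolding gval_def
proof (rule ptime_Max, rule ptime_map[OF cds])
  let ?E = "{p. fst p \<in> D \<and> snd p \<in> set (cds (fst p))}"
  show "ptime ?E (\<lambda>p. Node (e (fst p)) (enc_scenario (snd p)))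
      (\<lambda>p. Leaf (dot (fst (snd p)) (x (fst p)) - snd (snd p)))"
  proof (intro ptime_diff ptime_dot)
    show "ptime ?E (\<lambda>p. Node (e (fst p)) (enc_scenario (snd p))) (\<lambda>p. enc_list enc_int (fst (snd p)))"
      unfolding enc_scenario_def by (rule ptime_RL)
    show "ptime ?E (\<lambda>p. Node (e (fst p)) (enc_scenario (snd p))) (\<lambda>p. enc_list Leaf (x (fst p)))"
      by (rule ptime_env[OF x ptime_L]) simp
    show "ptime ?E (\<lambda>p. Node (e (fst p)) (enc_scenario (snd p))) (\<lambda>p. Leaf (snd (snd p)))"
      unfolding enc_scenario_def by (rule ptime_enc_intD, rule ptime_RR)
  qed (use len in auto)
qed (use ne in auto)

text \<open>Moves the zero of the objective to \<open>m\<close> while keeping the number of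
  scenarios. The ratio 2 then applies to the distance from \<open>m\<close>.\<close>

definition shift :: "int \<Rightarrow> bool list \<times> (int list \<times> int) list \<Rightarrow> bool list \<times> (int list \<times> int) list" where
  "shift m i = (fst i, map (\<lambda>cd. (fst cd, snd cd + m)) (snd i))"

lemma shift_int_gen_instances:
  "i \<in> int_gen_instances inst n K \<Longrightarrow> shift m i \<in> int_gen_instances inst n K"
  by (auto simp: int_gen_instances_def shift_def)

lemma gval_shift:
  assumes "snd i \<noteq> []"
  shows "gval (snd (shift m i)) x = gval (snd i) x - m"
proof -
  let ?V = "(\<lambda>cd. dot (fst cd) x - snd cd) ` set (snd i)"
  have "Max ((\<lambda>v. v - m) ` ?V) = Max ?V - m"
    using assms by (intro mono_Max_commute[symmetric]) (auto simp: mono_def)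
  then show ?thesis
    by (simp add: gval_def shift_def image_image algebra_simps)
qed

lemma ptime_shift:
  assumes i: "ptime D e (\<lambda>a. enc_int_gen (i a))" and m: "ptime D e (\<lambda>a. Leaf (m a))"
  shows "ptime D e (\<lambda>a. enc_int_gen (shift (m a) (i a)))"
proof -
  have "ptime D e (\<lambda>a. enc_list enc_scenario (map (\<lambda>cd. (fst cd, snd cd + m a)) (snd (i a))))"
  proof (rule ptime_map)
    show "ptime D e (\<lambda>a. enc_list enc_scenario (snd (i a)))"
      using i unfolding enc_int_gen_def by (rule ptime_snd)
    let ?E = "{p. fst p \<in> D \<and> snd p \<in> set (snd (i (fst p)))}"
    let ?e = "\<lambda>p. Node (e (fst p)) (enc_scenario (snd p))"
    have "ptime ?E ?e (\<lambda>p. enc_list enc_int (fst (snd p)))"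
      unfolding enc_scenario_def by (rule ptime_RL)
    moreover have "ptime ?E ?e (\<lambda>p. Leaf (snd (snd p)))"
      unfolding enc_scenario_def by (rule ptime_enc_intD, rule ptime_RR)
    moreover have "ptime ?E ?e (\<lambda>p. Leaf (m (fst p)))"
      by (rule ptime_env[OF m ptime_L]) simp
    ultimately show "ptime ?E ?e (\<lambda>p. enc_scenario (fst (snd p), snd (snd p) + m (fst p)))"
      unfolding enc_scenario_def[of "(_, _)"] fst_conv snd_conv
      by (intro ptime_Node ptime_enc_int ptime_add)
  qed
  with i show ?thesis
    unfolding enc_int_gen_def shift_def fst_conv snd_conv by (intro ptime_Node) (rule ptime_fst)
qed

text \<open>Squares serve as upper bounds of absolute values that need no case distinction.\<close>

definition gval_bound :: "(int list \<times> int) list \<Rightarrow> int" where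
  "gval_bound cds = sum_list (map (\<lambda>cd. sum_list (map (\<lambda>u. u * u) (fst cd)) + snd cd * snd cd) cds)"

lemma ptime_gval_bound:
  assumes "ptime D e (\<lambda>a. enc_list enc_scenario (cds a))"
  shows "ptime D e (\<lambda>a. Leaf (gval_bound (cds a)))"
  unfolding gval_bound_def
proof (rule ptime_sum_list, rule ptime_map[OF assms])
  let ?E = "{p. fst p \<in> D \<and> snd p \<in> set (cds (fst p))}"
  let ?e = "\<lambda>p. Node (e (fst p)) (enc_scenario (snd p))"
  have c: "ptime ?E ?e (\<lambda>p. enc_list enc_int (fst (snd p)))" and d: "ptime ?E ?e (\<lambda>p. Leaf (snd (snd p)))"
    unfolding enc_scenario_def by (rule ptime_RL, rule ptime_enc_intD, rule ptime_RR)
  have "ptime ?E ?e (\<lambda>p. enc_list Leaf (map (\<lambda>u. u * u) (fst (snd p))))"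
    by (rule ptime_map[OF c], rule ptime_mult) (rule ptime_enc_intD, rule ptime_R)+
  with d show "ptime ?E ?e (\<lambda>p. Leaf (sum_list (map (\<lambda>u. u * u) (fst (snd p))) + snd (snd p) * snd (snd p)))"
    by (intro ptime_add ptime_sum_list ptime_mult)
qed

lemma abs_le_square: "\<bar>u\<bar> \<le> u * (u :: int)"
proof -
  have "\<bar>u\<bar> * 1 \<le> \<bar>u\<bar> * \<bar>u\<bar>"
    by (cases "u = 0") (simp, rule mult_left_mono, simp_all)
  then show ?thesis by simp
qed

text \<open>Every product in \<open>dot\<close> is 0 or an entry \<open>u\<close> of
  \<open>c\<close>, and \<open>\<bar>u\<bar> \<le> u * u\<close>. Entries cut off by
  \<open>zip\<close> only add nonnegative squares on the right.\<close>

lemma abs_dot_le: "set x \<subseteq> {0, 1} \<Longrightarrow> \<bar>dot c x\<bar> \<le> sum_list (map (\<lambda>u. u * u) c)"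
proof (induct c arbitrary: x)
  case (Cons u c)
  show ?case
  proof (cases x)
    case Nil
    then show ?thesis
      using Cons.hyps[of "[]"] by (simp add: dot_def add_nonneg_nonneg)
  next
    case (Cons v y)
    with Cons.prems have "\<bar>dot c y\<bar> \<le> sum_list (map (\<lambda>u. u * u) c)" "v = 0 \<or> v = 1"
      using Cons.hyps[of y] by auto
    then show ?thesis
      using abs_le_square[of u] Cons by (auto simp: dot_def)
  qed
qed (simp add: dot_def)

text \<open>The maximum is attained by one scenario, whose own bound is one of the nonnegative
  summands of \<open>gval_bound\<close>.\<close>

lemma abs_gval_le:
  assumes "set x \<subseteq> {0, 1}" "cds \<noteq> []"
  shows "\<bar>gval cds x\<bar> \<le> gval_bound cds"
proof -
  have "gval cds x \<in> (\<lambda>cd. dot (fst cd) x - snd cd) ` set cds"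
    unfolding gval_def set_map using assms(2) by (intro Max_in) auto
  then obtain cd where cd: "cd \<in> set cds" "gval cds x = dot (fst cd) x - snd cd"
    by blast
  let ?f = "\<lambda>cd. sum_list (map (\<lambda>u. u * u) (fst cd)) + snd cd * snd cd :: int"
  have nonneg: "0 \<le> ?f cd" for cd :: "int list \<times> int"
    by (intro add_nonneg_nonneg sum_list_nonneg) auto
  have "?f cd \<le> sum_list (map ?f cds)"
    using cd(1)
  proof (induct cds)
    case (Cons a cds)
    then show ?case
      using nonneg[of a] sum_list_nonneg[of "map ?f cds"] nonneg by fastforce
  qed simp
  then show ?thesis
    using cd(2) abs_dot_le[OF assms(1), of "fst cd"] abs_le_square[of "snd cd"]
    unfolding gval_bound_def by linarith
qed

lemma cost_eq_dot:
  assumes "length x = length c"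
  shows "cost (map real_of_rat (map of_int c)) x = of_int (dot c x)"
proof -
  have "dot c x = (\<Sum>j<length c. c ! j * x ! j)"
    using assms by (simp add: dot_def sum_list_sum_nth atLeast0LessThan)
  then show ?thesis
    by (simp add: cost_def)
qed

lemma problem_classD:
  assumes "problem_class inst n X" "I \<in> inst"
  shows "finite (X I)" "X I \<noteq> {}" "\<And>x. x \<in> X I \<Longrightarrow> length x = n I \<and> set x \<subseteq> {0, 1}"
proof -
  have "X I \<subseteq> {x. set x \<subseteq> {0, 1} \<and> length x = n I}" "X I \<noteq> {}"
    using assms by (auto simp: problem_class_def binary_vectors_def)
  then show "finite (X I)" "X I \<noteq> {}" "\<And>x. x \<in> X I \<Longrightarrow> length x = n I \<and> set x \<subseteq> {0, 1}"
    by (auto intro: finite_subset[OF _ finite_lists_length_eq])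
qed

text \<open>Multiplication by a nonnegative \<alpha> preserves order, so comparing with the minimum
  amounts to comparing with every feasible value.\<close>

lemma approximation_iff:
  assumes "finite S" "S \<noteq> {}" "0 \<le> \<alpha>"
  shows "approximation \<alpha> S f x \<longleftrightarrow> x \<in> S \<and> (\<forall>y \<in> S. f x \<le> \<alpha> * f y)"
proof -
  have "Min (f ` S) \<in> f ` S"
    using assms by (intro Min_in) auto
  moreover have "\<alpha> * Min (f ` S) \<le> \<alpha> * f y" if "y \<in> S" for y
    using assms that by (intro mult_left_mono Min_le) auto
  ultimately show ?thesis
    unfolding approximation_def by (metis (no_types, lifting) image_iff order_trans)
qed

definition rat_gen :: "bool list \<times> (int list \<times> int) list \<Rightarrow> bool list \<times> (rat list \<times> rat) list" where
  "rat_gen i = (fst i, map (\<lambda>cd. (map of_int (fst cd), of_int (snd cd))) (snd i))"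

lemma enc_list_map: "enc_list h (map f l) = enc_list (h \<circ> f) l"
  by (induct l) auto

text \<open>The two encodings are the same tree: the given program runs on integral instances
  without conversion, with unchanged time bound.\<close>

lemma enc_gen_rat_gen: "enc_gen (rat_gen i) = enc_int_gen i"
proof -
  have *: "enc_rat \<circ> of_int = enc_int"
    by (auto simp: fun_eq_iff enc_rat_def enc_int_def)
  have "(\<lambda>(c, d). Node (enc_list enc_rat c) (enc_rat d)) \<circ>
      (\<lambda>cd. (map of_int (fst cd), of_int (snd cd))) = enc_scenario"
    by (auto simp: fun_eq_iff enc_scenario_def enc_list_map * *[unfolded fun_eq_iff, simplified])
  then show ?thesis
    by (simp add: enc_gen_def rat_gen_def enc_int_gen_def enc_list_map)
qed

lemma rat_gen_instances:
  "i \<in> int_gen_instances inst n K \<Longrightarrow> rat_gen i \<in> gen_instances inst n K"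
  by (auto simp: int_gen_instances_def gen_instances_def rat_gen_def)

lemma gen_obj_rat_gen:
  assumes "\<forall>cd \<in> set (snd i). length (fst cd) = length x" "snd i \<noteq> []"
  shows "gen_obj (rat_gen i) x = of_int (gval (snd i) x)"
proof -
  let ?V = "(\<lambda>cd. dot (fst cd) x - snd cd) ` set (snd i)"
  have "real_of_int (Max ?V) = Max (real_of_int ` ?V)"
    using assms(2) by (intro mono_Max_commute) (auto simp: mono_def)
  also have "real_of_int ` ?V = (\<lambda>(c, d). cost c x - d) ` set (map (\<lambda>(c, d). (map real_of_rat c, real_of_rat d)) (snd (rat_gen i)))"
    using assms(1) by (force simp: rat_gen_def image_image cost_eq_dot[unfolded map_map] intro!: image_cong)
  finally show ?thesis
    by (simp add: gen_obj_def gen_max_regret_def gval_def rat_gen_def)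
qed

section \<open>Exact solution with a fixed number of scenarios\<close>

text \<open>The guarantee of the given algorithm is conditional on the existence of a
  2-approximation. Nonnegativity of the objective is a condition on the instance that ensures
  it.\<close>

lemma integral_oracle:
  assumes pc: "problem_class inst n X" and K: "K \<ge> 1"
    and P: "poly_time_approx P (gen_instances inst n K) enc_gen (\<lambda>(I, _). X I) gen_obj (\<lambda>_. 2)"
  shows "\<exists>orc. ptime (int_gen_instances inst n K) enc_int_gen (\<lambda>i. enc_list Leaf (orc i)) \<and>
    (\<forall>i \<in> int_gen_instances inst n K. orc i \<in> X (fst i) \<and>
      ((\<forall>y \<in> X (fst i). 0 \<le> gval (snd i) y) \<longrightarrow>
        (\<forall>y \<in> X (fst i). gval (snd i) (orc i) \<le> 2 * gval (snd i) y)))"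
proof -
  let ?D = "int_gen_instances inst n K"
  from P obtain q :: "nat poly" where q: "\<forall>i \<in> gen_instances inst n K. \<exists>x t.
      run P (enc_gen i) (enc_list Leaf x) t \<and> t \<le> poly q (tsize (enc_gen i)) \<and> x \<in> X (fst i) \<and>
      ((\<exists>y. approximation 2 (X (fst i)) (gen_obj i) y) \<longrightarrow> approximation 2 (X (fst i)) (gen_obj i) x)"
    unfolding poly_time_approx_def by (force simp: case_prod_unfold)
  have "\<forall>i \<in> ?D. \<exists>x. (\<exists>t. run P (enc_int_gen i) (enc_list Leaf x) t \<and> t \<le> poly q (tsize (enc_int_gen i))) \<and>
      x \<in> X (fst i) \<and> ((\<forall>y \<in> X (fst i). 0 \<le> gval (snd i) y) \<longrightarrow>
        (\<forall>y \<in> X (fst i). gval (snd i) x \<le> 2 * gval (snd i) y))"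
  proof
    fix i assume i: "i \<in> ?D"
    then have inst: "fst i \<in> inst" and ne: "snd i \<noteq> []"
      using K by (auto simp: int_gen_instances_def)
    note X = problem_classD[OF pc inst]
    have obj: "gen_obj (rat_gen i) y = of_int (gval (snd i) y)" if "y \<in> X (fst i)" for y
      using X(3)[OF that] i ne by (intro gen_obj_rat_gen) (auto simp: int_gen_instances_def)
    have approx: "approximation 2 (X (fst i)) (gen_obj (rat_gen i)) y \<longleftrightarrow>
        y \<in> X (fst i) \<and> (\<forall>z \<in> X (fst i). gval (snd i) y \<le> 2 * gval (snd i) z)" for y
    proof -
      have "real_of_int a \<le> 2 * real_of_int b \<longleftrightarrow> a \<le> 2 * b" for a b
        by linarith
      then show ?thesis
        using X(1,2) obj by (simp add: approximation_iff cong: conj_cong)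
    qed
    have "fst (rat_gen i) = fst i"
      by (simp add: rat_gen_def)
    with q[rule_format, OF rat_gen_instances[OF i]] obtain x t where x: "run P (enc_int_gen i) (enc_list Leaf x) t"
      "t \<le> poly q (tsize (enc_int_gen i))" "x \<in> X (fst i)"
      "(\<exists>y. approximation 2 (X (fst i)) (gen_obj (rat_gen i)) y) \<longrightarrow>
        approximation 2 (X (fst i)) (gen_obj (rat_gen i)) x"
      unfolding enc_gen_rat_gen by auto
    have "\<forall>y \<in> X (fst i). gval (snd i) x \<le> 2 * gval (snd i) y"
      if nonneg: "\<forall>y \<in> X (fst i). 0 \<le> gval (snd i) y"
    proof -
      obtain y where y: "y \<in> X (fst i)" "\<forall>z \<in> X (fst i). gval (snd i) y \<le> gval (snd i) z"
        using ex_min_if_finite[of "gval (snd i) ` X (fst i)"] X(1,2) by (fastforce simp: not_less)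
      \<comment> \<open>A minimiser of a nonnegative objective is itself a 2-approximation.\<close>
      have "approximation 2 (X (fst i)) (gen_obj (rat_gen i)) y"
        unfolding approx using y nonneg by force
      with x(4) show ?thesis
        unfolding approx by blast
    qed
    with x show "\<exists>x. (\<exists>t. run P (enc_int_gen i) (enc_list Leaf x) t \<and> t \<le> poly q (tsize (enc_int_gen i))) \<and>
      x \<in> X (fst i) \<and> ((\<forall>y \<in> X (fst i). 0 \<le> gval (snd i) y) \<longrightarrow>
        (\<forall>y \<in> X (fst i). gval (snd i) x \<le> 2 * gval (snd i) y))"
      by blast
  qed
  then obtain orc where orc: "\<forall>i \<in> ?D. (\<exists>t. run P (enc_int_gen i) (enc_list Leaf (orc i)) t \<and>
        t \<le> poly q (tsize (enc_int_gen i))) \<and>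
      orc i \<in> X (fst i) \<and> ((\<forall>y \<in> X (fst i). 0 \<le> gval (snd i) y) \<longrightarrow>
        (\<forall>y \<in> X (fst i). gval (snd i) (orc i) \<le> 2 * gval (snd i) y))"
    unfolding bchoice_iff by (elim exE)
  have "ptime ?D enc_int_gen (\<lambda>i. enc_list Leaf (orc i))"
    by (rule ptimeI[where P = P, OF _ pbound_poly[where q = q, OF pbound_size]]) (use orc in simp)
  with orc show ?thesis by (intro exI[of _ orc]) simp
qed

text \<open>The new bound is the midpoint of \<open>l\<close> and \<open>h\<close>, rounded up. The
  ratio puts the midpoint at or below the integer \<open>v\<close>, so rounding up does not pass
  \<open>v\<close>. By \<open>v \<le> h\<close> the gap to \<open>v\<close> is at most half the old
  one, and \<open>r\<close> is an upper bound on that gap. The fixed \<open>b\<close> keeps the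
  lower bounds from drifting down.\<close>

lemma bisection_step:
  fixes b l v r h :: int
  assumes "b \<le> l" "l \<le> v" "v \<le> l + r" "v \<le> h" "h - l \<le> 2 * (v - l)"
  shows "b \<le> (l + h + 1) div 2 \<and> (l + h + 1) div 2 \<le> v \<and> v \<le> (l + h + 1) div 2 + r div 2"
proof -
  define q s where "q = (l + h + 1) div 2" and "s = r div 2"
  have q: "2 * q \<le> l + h + 1" "l + h + 1 \<le> 2 * q + 1" and s: "r \<le> 2 * s + 1"
    unfolding q_def s_def by simp_all
  from q(2) assms(1,2,4) have "b \<le> q"
    by linarith
  moreover from q(1) assms(5) have "q \<le> v"
    by presburger
  moreover from q(2) s assms(3,4) have "v \<le> q + s"
    by presburger
  ultimately show ?thesis
    by (simp only: q_def s_def)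
qed

lemma exact_solver:
  assumes pc: "problem_class inst n X" and K: "K \<ge> 1"
    and P: "poly_time_approx P (gen_instances inst n K) enc_gen (\<lambda>(I, _). X I) gen_obj (\<lambda>_. 2)"
  shows "\<exists>sol. ptime (int_gen_instances inst n K) enc_int_gen (\<lambda>i. enc_list Leaf (sol i)) \<and>
    (\<forall>i \<in> int_gen_instances inst n K. sol i \<in> X (fst i) \<and>
      (\<forall>y \<in> X (fst i). gval (snd i) (sol i) \<le> gval (snd i) y))"
proof -
  let ?D = "int_gen_instances inst n K"
  from integral_oracle[OF assms] obtain orc where
    orc_ptime: "ptime ?D enc_int_gen (\<lambda>i. enc_list Leaf (orc i))" and
    orc: "\<And>i. i \<in> ?D \<Longrightarrow> orc i \<in> X (fst i)" and
    orc_le: "\<And>i y. i \<in> ?D \<Longrightarrow> \<forall>y \<in> X (fst i). 0 \<le> gval (snd i) y \<Longrightarrow> y \<in> X (fst i) \<Longrightarrow>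
      gval (snd i) (orc i) \<le> 2 * gval (snd i) y"
    by blast
  define step where "step i m = (m + gval (snd i) (orc (shift m i)) + 1) div 2" for i m
  define lo where "lo i k = (step i ^^ k) (- gval_bound (snd i))" for i k
  \<comment> \<open>All values lie between \<open>- gval_bound (snd i)\<close> and
    \<open>gval_bound (snd i)\<close>, so \<open>R i\<close> bounds the gap at the start.\<close>
  define R where "R i = 2 * gval_bound (snd i)" for i :: "bool list \<times> (int list \<times> int) list"
  \<comment> \<open>After as many halvings as \<open>R i\<close> has bits, the gap is 0.\<close>
  define N where "N i = nat (bitlen (R i))" for i
  \<comment> \<open>One more call at the tight lower bound: twice a zero distance is zero, so the
    answer is optimal.\<close>
  define sol where "sol i = orc (shift (lo i (N i)) i)" for i
  have D: "fst i \<in> inst" "snd i \<noteq> []" "\<And>cd. cd \<in> set (snd i) \<Longrightarrow> length (fst cd) = n (fst i)"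
    if "i \<in> ?D" for i
    using that K by (auto simp: int_gen_instances_def)
  have bound: "\<bar>gval (snd i) y\<bar> \<le> gval_bound (snd i)" if "i \<in> ?D" "y \<in> X (fst i)" for i y
    using problem_classD(3)[OF pc D(1)[OF that(1)] that(2)] D(2)[OF that(1)] by (intro abs_gval_le) auto
  have "\<exists>y \<in> X (fst i). \<forall>z \<in> X (fst i). gval (snd i) y \<le> gval (snd i) z" if "i \<in> ?D" for i
    using ex_min_if_finite[of "gval (snd i) ` X (fst i)"] problem_classD(1,2)[OF pc D(1)[OF that]]
    by (fastforce simp: not_less)
  \<comment> \<open>\<open>best\<close> serves the analysis only; no program computes it.\<close>
  then obtain best where best: "\<And>i. i \<in> ?D \<Longrightarrow> best i \<in> X (fst i)"
    "\<And>i z. i \<in> ?D \<Longrightarrow> z \<in> X (fst i) \<Longrightarrow> gval (snd i) (best i) \<le> gval (snd i) z"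
    by metis
  have orc_shift: "orc (shift m i) \<in> X (fst i)"
    "m \<le> gval (snd i) (best i) \<Longrightarrow> gval (snd i) (orc (shift m i)) - m \<le> 2 * (gval (snd i) (best i) - m)"
    if i: "i \<in> ?D" for i m
  proof -
    have s: "shift m i \<in> ?D" "fst (shift m i) = fst i"
      using i by (auto simp: shift_int_gen_instances) (simp add: shift_def)
    show "orc (shift m i) \<in> X (fst i)"
      using orc[OF s(1)] s(2) by simp
    assume "m \<le> gval (snd i) (best i)"
    then have "\<forall>y \<in> X (fst i). 0 \<le> gval (snd (shift m i)) y"
      using best(2)[OF i] by (force simp: gval_shift[OF D(2)[OF i]])
    with orc_le[OF s(1), of "best i"] s(2) best(1)[OF i]
    show "gval (snd i) (orc (shift m i)) - m \<le> 2 * (gval (snd i) (best i) - m)"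
      by (simp add: gval_shift[OF D(2)[OF i]])
  qed
  have R_Suc: "R i div 2 ^ Suc k = R i div 2 ^ k div 2" for i k
    unfolding power_Suc2 by (rule zdiv_zmult2_eq) simp
  \<comment> \<open>The first two inequalities keep \<open>lo i k\<close> small in absolute value,
    hence of polynomial size. The third is the halved gap.\<close>
  have inv: "- gval_bound (snd i) \<le> lo i k \<and> lo i k \<le> gval (snd i) (best i) \<and>
      gval (snd i) (best i) \<le> lo i k + R i div 2 ^ k" if i: "i \<in> ?D" for i k
  proof (induction k)
    case 0
    then show ?case
      using bound[OF i best(1)[OF i]] by (simp add: lo_def R_def abs_le_iff)
  next
    case (Suc k)
    let ?h = "gval (snd i) (orc (shift (lo i k) i))"
    have lo: "lo i (Suc k) = (lo i k + ?h + 1) div 2"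
      by (simp add: lo_def step_def)
    have "gval (snd i) (best i) \<le> ?h" "?h - lo i k \<le> 2 * (gval (snd i) (best i) - lo i k)"
      using best(2)[OF i orc_shift(1)[OF i]] orc_shift(2)[OF i] Suc.IH by auto
    with Suc.IH bisection_step[of _ "lo i k"] show ?case
      unfolding lo R_Suc by blast
  qed
  have R0: "0 \<le> R i" if "i \<in> ?D" for i
    using bound[OF that best(1)[OF that]] by (simp add: R_def)
  \<comment> \<open>The current gap doubles as the loop counter: it is positive exactly as long as
    rounds remain.\<close>
  have N: "0 < R i div 2 ^ k \<longleftrightarrow> k < N i" if "i \<in> ?D" for i k
  proof -
    have "0 < R i div 2 ^ k \<longleftrightarrow> 2 ^ k \<le> R i"
      using R0[OF that] by (simp add: pos_imp_zdiv_pos_iff)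
    also have "\<dots> \<longleftrightarrow> \<not> bitlen (R i) \<le> int k"
      using bitlen_le_iff_power[of "R i" k] by (simp add: not_less)
    finally show ?thesis
      unfolding N_def by auto
  qed
  have "lo i (N i) = gval (snd i) (best i)" if "i \<in> ?D" for i
    using inv[OF that, of "N i"] N[OF that, of "N i"] by linarith
  then have opt: "gval (snd i) (sol i) \<le> gval (snd i) y" if "i \<in> ?D" "y \<in> X (fst i)" for i y
    using orc_shift(2)[OF that(1), of "lo i (N i)"] best(2)[OF that] that(1) by (simp add: sol_def)
  have cds: "ptime ?D enc_int_gen (\<lambda>i. enc_list enc_scenario (snd i))"
    unfolding enc_int_gen_def by (rule ptime_R)
  have gb: "ptime ?D enc_int_gen (\<lambda>i. Leaf (gval_bound (snd i)))"
    by (rule ptime_gval_bound[OF cds])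
  have R: "ptime ?D enc_int_gen (\<lambda>i. Leaf (R i))"
    unfolding R_def by (rule ptime_mult[OF ptime_const gb])
  define st where "st i k = Node (enc_int_gen i) (Node (Leaf (R i div 2 ^ k)) (Leaf (lo i k)))" for i k
  have "ptime ?D enc_int_gen (\<lambda>i. st i (N i))"
  proof (rule ptime_iterate)
    have "ptime ?D enc_int_gen (\<lambda>i. Leaf (0 - gval_bound (snd i)))"
      by (rule ptime_diff[OF ptime_const gb])
    with R show "ptime ?D enc_int_gen (\<lambda>i. st i 0)"
      unfolding st_def lo_def by (auto intro!: ptime_Node ptime_id)
  next
    let ?E = "{p. fst p \<in> ?D \<and> snd p < N (fst p)}"
    let ?e = "\<lambda>p. st (fst p) (snd p)"
    have i: "ptime ?E ?e (\<lambda>p. enc_int_gen (fst p))" and r: "ptime ?E ?e (\<lambda>p. Leaf (R (fst p) div 2 ^ snd p))"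
      and lo: "ptime ?E ?e (\<lambda>p. Leaf (lo (fst p) (snd p)))"
      unfolding st_def by (rule ptime_L ptime_RL ptime_RR)+
    have x: "ptime ?E ?e (\<lambda>p. enc_list Leaf (orc (shift (lo (fst p) (snd p)) (fst p))))"
      by (rule ptime_env[OF orc_ptime ptime_shift[OF i lo]]) (simp add: shift_int_gen_instances)
    have "ptime ?E ?e (\<lambda>p. Leaf (gval (snd (fst p)) (orc (shift (lo (fst p) (snd p)) (fst p)))))"
    proof (rule ptime_gval[OF _ x])
      show "ptime ?E ?e (\<lambda>p. enc_list enc_scenario (snd (fst p)))"
        by (rule ptime_env[OF cds i]) simp
    next
      fix p cd assume p: "p \<in> ?E" and "cd \<in> set (snd (fst p))"
      then show "length (fst cd) = length (orc (shift (lo (fst p) (snd p)) (fst p)))"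
        using D(3)[of "fst p" cd] D(1)[of "fst p"]
          problem_classD(3)[OF pc _ orc_shift(1)[of "fst p" "lo (fst p) (snd p)"]] by auto
    qed (use D(2) in auto)
    then have "ptime ?E ?e (\<lambda>p. Leaf (lo (fst p) (Suc (snd p))))"
      unfolding lo_def[of _ "Suc _"] funpow.simps o_apply lo_def[symmetric]
      unfolding step_def
      by (intro ptime_div ptime_add ptime_const lo)
    moreover have "ptime ?E ?e (\<lambda>p. Leaf (R (fst p) div 2 ^ Suc (snd p)))"
      unfolding R_Suc by (rule ptime_div[OF r ptime_const])
    ultimately show "ptime ?E ?e (\<lambda>p. st (fst p) (Suc (snd p)))"
      unfolding st_def[of _ "Suc _"] using i by (intro ptime_Node)
  next
    let ?E = "{p. fst p \<in> ?D \<and> snd p \<le> N (fst p)}"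
    let ?e = "\<lambda>p. st (fst p) (snd p)"
    have "ptime ?E ?e (\<lambda>p. Leaf (R (fst p) div 2 ^ snd p))"
      unfolding st_def by (rule ptime_RL)
    from ptime_le[OF ptime_const this, of 1]
    show "ptime ?E ?e (\<lambda>p. Leaf (of_bool (snd p < N (fst p))))"
      by (rule ptime_cong) (simp add: N int_one_le_iff_zero_less)
  next
    show "pbound ?D enc_int_gen N"
      by (rule pbound_mono[OF ptime_pbound[OF R]]) (simp add: N_def R0)
  next
    show "pbound ?D enc_int_gen (\<lambda>i. tsize (enc_int_gen i) + (tsize (Leaf (R i)) + tsize (Leaf (R i))) + 2)"
      by (intro pbound_add pbound_const pbound_size ptime_pbound R)
  next
    fix i k assume i: "i \<in> ?D"
    have "\<bar>lo i k\<bar> \<le> \<bar>R i\<bar>"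
      using inv[OF i, of k] bound[OF i best(1)[OF i]] unfolding R_def by linarith
    then have "tsize (Leaf (lo i k)) \<le> tsize (Leaf (R i))"
      by (rule tsize_Leaf_mono)
    moreover have "tsize (Leaf (R i div 2 ^ k)) \<le> tsize (Leaf (R i))"
      by (rule tsize_Leaf_mono[OF abs_div_le])
    ultimately show "tsize (st i k) \<le> tsize (enc_int_gen i) + (tsize (Leaf (R i)) + tsize (Leaf (R i))) + 2"
      unfolding st_def tsize.simps(2) by linarith
  qed
  then have "ptime ?D enc_int_gen (\<lambda>i. Leaf (lo i (N i)))"
    unfolding st_def by (rule ptime_snd[OF ptime_snd])
  from ptime_env[OF orc_ptime ptime_shift[OF ptime_id this]]
  have "ptime ?D enc_int_gen (\<lambda>i. enc_list Leaf (sol i))"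
    unfolding sol_def by (simp add: shift_int_gen_instances)
  with opt orc_shift(1) show ?thesis
    by (intro exI[of _ sol]) (auto simp: sol_def)
qed

section \<open>Grouping scenarios\<close>

definition scenario_value :: "int list \<times> int \<Rightarrow> int list \<Rightarrow> int" where
  "scenario_value s x = dot (fst s) x - snd s"

lemma gval_eq: "gval ss x = Max ((\<lambda>s. scenario_value s x) ` set ss)"
  by (simp add: gval_def scenario_value_def)

definition add_scenario :: "int list \<times> int \<Rightarrow> int list \<times> int \<Rightarrow> int list \<times> int" where
  "add_scenario s t = (map (\<lambda>q. fst q + snd q) (zip (fst s) (fst t)), snd s + snd t)"

lemma scenario_value_add:
  assumes "length (fst s) = length x" "length (fst t) = length x"
  shows "scenario_value (add_scenario s t) x = scenario_value s x + scenario_value t x"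
proof -
  have "dot (map (\<lambda>q. fst q + snd q) (zip c d)) x = dot c x + dot d x"
    if "length c = length d" "length d = length x" for c d
    using that
    by (induct c d x rule: list_induct3) (auto simp: dot_def algebra_simps)
  with assms show ?thesis
    by (simp add: scenario_value_def add_scenario_def)
qed

lemma tsize_add_scenario:
  assumes "length (fst s) = length (fst t)"
  shows "tsize (enc_scenario (add_scenario s t)) \<le> tsize (enc_scenario s) + tsize (enc_scenario t)"
proof -
  have int: "tsize (enc_int (u + v)) \<le> tsize (enc_int u) + tsize (enc_int v)" for u v
    using tsize_Leaf_add[of u v] by (simp add: enc_int_def)
  have "tsize (enc_list enc_int (map (\<lambda>q. fst q + snd q) (zip c d)))
      \<le> tsize (enc_list enc_int c) + tsize (enc_list enc_int d)"
    if "length c = length d" for c d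
    using that
  proof (induct c d rule: list_induct2)
    case (Cons u c v d)
    then show ?case using int[of u v] by simp
  qed simp
  from this[OF assms] int[of "snd s" "snd t"] show ?thesis
    by (simp add: enc_scenario_def add_scenario_def)
qed

lemma ptime_add_scenario:
  assumes s: "ptime D e (\<lambda>a. enc_scenario (s a))" and t: "ptime D e (\<lambda>a. enc_scenario (t a))"
    and len: "\<And>a. a \<in> D \<Longrightarrow> length (fst (s a)) = length (fst (t a))"
  shows "ptime D e (\<lambda>a. enc_scenario (add_scenario (s a) (t a)))"
proof -
  have "ptime D e (\<lambda>a. enc_list enc_int (map (\<lambda>q. fst q + snd q) (zip (fst (s a)) (fst (t a)))))"
  proof (rule ptime_map[OF ptime_zip[OF _ _ len]])
    show "ptime D e (\<lambda>a. enc_list enc_int (fst (s a)))" "ptime D e (\<lambda>a. enc_list enc_int (fst (t a)))"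
      by (rule ptime_fst[OF s[unfolded enc_scenario_def]], rule ptime_fst[OF t[unfolded enc_scenario_def]])
    show "ptime {p. fst p \<in> D \<and> snd p \<in> set (zip (fst (s (fst p))) (fst (t (fst p))))}
        (\<lambda>p. Node (e (fst p)) (Node (enc_int (fst (snd p))) (enc_int (snd (snd p)))))
        (\<lambda>p. enc_int (fst (snd p) + snd (snd p)))"
      by (rule ptime_enc_int, rule ptime_add) (rule ptime_enc_intD, rule ptime_RL ptime_RR)+
  qed
  moreover have "ptime D e (\<lambda>a. Leaf (snd (s a)))" "ptime D e (\<lambda>a. Leaf (snd (t a)))"
    by (rule ptime_enc_intD[OF ptime_snd[OF s[unfolded enc_scenario_def]]],
        rule ptime_enc_intD[OF ptime_snd[OF t[unfolded enc_scenario_def]]])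
  ultimately show ?thesis
    unfolding enc_scenario_def add_scenario_def fst_conv snd_conv
    by (intro ptime_Node ptime_enc_int ptime_add)
qed

text \<open>The list of groups is a queue: the front group receives the scenario and moves to the
  back. Scenarios are thus dealt evenly without index arithmetic.\<close>

definition round_robin :: "(int list \<times> int) list \<Rightarrow> int list \<times> int \<Rightarrow> (int list \<times> int) list" where
  "round_robin gs s = tl gs @ [add_scenario (hd gs) s]"

lemma ptime_snoc:
  assumes "ptime D e (\<lambda>a. enc_list h (l a))" "ptime D e (\<lambda>a. h (x a))"
  shows "ptime D e (\<lambda>a. enc_list h (l a @ [x a]))"
  using ptime_rev[OF ptime_Cons[OF assms(2) ptime_rev[OF assms(1)]]] by simp

text \<open>Sizes are subadditive under \<open>add_scenario\<close>, so each step adds at most the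
  size of the scenario dealt. The invariant supplies the equal lengths needed for adding cost
  vectors.\<close>

lemma ptime_round_robin:
  assumes ss: "ptime D e (\<lambda>a. enc_list enc_scenario (ss a))"
    and gs: "ptime D e (\<lambda>a. enc_list enc_scenario (gs a))"
    and "\<And>a s. a \<in> D \<Longrightarrow> s \<in> set (ss a) \<Longrightarrow> length (fst s) = m a"
      "\<And>a s. a \<in> D \<Longrightarrow> s \<in> set (gs a) \<Longrightarrow> length (fst s) = m a"
      "\<And>a. a \<in> D \<Longrightarrow> gs a \<noteq> []"
  shows "ptime D e (\<lambda>a. enc_list enc_scenario (foldl round_robin (gs a) (ss a)))"
proof (rule ptime_foldl[where Inv = "\<lambda>a gs. gs \<noteq> [] \<and> (\<forall>s \<in> set gs. length (fst s) = m a)"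
      and s = "enc_list enc_scenario", OF ss gs])
  let ?E = "{p. fst p \<in> D \<and> (fst (snd p) \<noteq> [] \<and> (\<forall>s \<in> set (fst (snd p)). length (fst s) = m (fst p))) \<and>
      snd (snd p) \<in> set (ss (fst p))}"
  let ?e = "\<lambda>p. Node (e (fst p)) (Node (enc_list enc_scenario (fst (snd p))) (enc_scenario (snd (snd p))))"
  have gs: "ptime ?E ?e (\<lambda>p. enc_list enc_scenario (fst (snd p)))"
    by (rule ptime_RL)
  have s: "ptime ?E ?e (\<lambda>p. enc_scenario (snd (snd p)))"
    by (rule ptime_RR)
  show "ptime ?E ?e (\<lambda>p. enc_list enc_scenario (round_robin (fst (snd p)) (snd (snd p))))"
    unfolding round_robin_def
    by (rule ptime_snoc[OF ptime_tl[OF gs] ptime_add_scenario[OF ptime_hd[OF gs] s]])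
      (use assms(3) in auto)
next
  show "pbound D e (\<lambda>a. tsize (enc_list enc_scenario (ss a)))"
    by (rule ptime_pbound[OF ss])
next
  fix a and gs :: "(int list \<times> int) list" and s
  assume a: "a \<in> D" "gs \<noteq> [] \<and> (\<forall>s \<in> set gs. length (fst s) = m a)" "s \<in> set (ss a)"
  then obtain g hs where gs: "gs = g # hs"
    by (cases gs) auto
  have "length (fst s) = m a"
    using a assms(3) by blast
  with a gs show "round_robin gs s \<noteq> [] \<and> (\<forall>s \<in> set (round_robin gs s). length (fst s) = m a)"
    by (auto simp: round_robin_def add_scenario_def)
  have "tsize (enc_scenario (add_scenario g s)) \<le> tsize (enc_scenario g) + tsize (enc_scenario s)"
    using a gs \<open>length (fst s) = m a\<close> by (intro tsize_add_scenario) simp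
  with tsize_member_le[OF a(3), of enc_scenario]
  show "tsize (enc_list enc_scenario (round_robin gs s))
      \<le> tsize (enc_list enc_scenario gs) + tsize (enc_list enc_scenario (ss a))"
    by (simp add: gs round_robin_def tsize_enc_list)
qed (use assms in auto)

text \<open>The effect of \<open>round_robin\<close> on the list of group values at a fixed
  solution.\<close>

definition rotate_add :: "int list \<Rightarrow> int \<Rightarrow> int list" where
  "rotate_add vs r = tl vs @ [hd vs + r]"

text \<open>Evaluation at a fixed \<open>x\<close> is additive in the scenario, so it commutes with
  dealing. The estimates below can then be made on lists of integers.\<close>

lemma scenario_values_round_robin:
  assumes "gs \<noteq> []" "\<And>s. s \<in> set gs \<Longrightarrow> length (fst s) = length x"
    "\<And>s. s \<in> set ss \<Longrightarrow> length (fst s) = length x"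
  shows "map (\<lambda>s. scenario_value s x) (foldl round_robin gs ss) =
    foldl rotate_add (map (\<lambda>s. scenario_value s x) gs) (map (\<lambda>s. scenario_value s x) ss)"
  using assms
proof (induct ss arbitrary: gs)
  case (Cons s ss)
  then obtain g hs where gs: "gs = g # hs"
    by (cases gs) auto
  have len: "length (fst g) = length x" "length (fst s) = length x"
    "\<And>t. t \<in> set hs \<Longrightarrow> length (fst t) = length x"
    by (rule Cons.prems(2,3); simp add: gs)+
  have "map (\<lambda>s. scenario_value s x) (round_robin gs s) =
      rotate_add (map (\<lambda>s. scenario_value s x) gs) (scenario_value s x)"
    by (simp add: gs round_robin_def rotate_add_def scenario_value_add len)
  moreover have "length (fst s') = length x" if "s' \<in> set (round_robin gs s)" for s'
    using that by (auto simp: gs round_robin_def add_scenario_def len)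
  moreover have "round_robin gs s \<noteq> []"
    by (simp add: round_robin_def)
  ultimately show ?case
    using Cons by simp
qed simp

text \<open>Nonnegative increments never decrease an entry, and the entry that receives
  \<open>r\<close> is at least \<open>r\<close> from then on. Entries of \<open>vs\<close> are
  included to carry this through the induction.\<close>

lemma rotate_add_lower:
  assumes "vs \<noteq> []" "\<forall>v \<in> set vs. 0 \<le> v" "\<forall>r \<in> set rs. 0 \<le> r" "r \<in> set vs \<union> set rs"
  shows "\<exists>v \<in> set (foldl rotate_add vs rs). r \<le> v"
  using assms
proof (induct rs arbitrary: vs r)
  case (Cons r' rs)
  then obtain w ws where vs: "vs = w # ws"
    by (cases vs) auto
  have w: "0 \<le> w" "0 \<le> r'"
    using Cons.prems vs by auto
  have IH: "\<exists>v \<in> set (foldl rotate_add (rotate_add vs r') rs). u \<le> v"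
    if "u \<in> set (rotate_add vs r') \<union> set rs" for u
    using that Cons.prems w by (intro Cons.hyps) (auto simp: vs rotate_add_def)
  have "\<exists>u \<in> set (rotate_add vs r') \<union> set rs. r \<le> u"
    using Cons.prems(4) w by (auto simp: vs rotate_add_def)
  with IH show ?case
    by (auto intro: order_trans)
qed auto

text \<open>After \<open>k\<close> values have been dealt to \<open>K\<close> groups, the group at
  position \<open>j\<close> has received \<open>(k + j) div K\<close> of them. Each dealing moves a
  group forward by one while \<open>k\<close> grows by one, which leaves \<open>k + j\<close>
  unchanged.\<close>

lemma rotate_add_upper:
  assumes "length vs = K" "\<And>j. j < K \<Longrightarrow> vs ! j \<le> int ((k + j) div K) * m" "\<forall>r \<in> set rs. r \<le> m" "0 < K"
  shows "length (foldl rotate_add vs rs) = K \<and>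
    (\<forall>j < K. foldl rotate_add vs rs ! j \<le> int ((k + length rs + j) div K) * m)"
  using assms
proof (induct rs arbitrary: vs k)
  case (Cons r rs)
  then obtain w ws where vs: "vs = w # ws"
    by (cases vs) auto
  have "rotate_add vs r ! j \<le> int ((Suc k + j) div K) * m" if "j < K" for j
  proof (cases "Suc j < K")
    case True
    then have "rotate_add vs r ! j = vs ! Suc j"
      using Cons.prems(1) by (simp add: vs rotate_add_def nth_append)
    then show ?thesis
      using Cons.prems(2)[OF True] by simp
  next
    case False
    with that have j: "Suc j = K" by simp
    then have "rotate_add vs r ! j = w + r"
      using Cons.prems(1) by (simp add: vs rotate_add_def nth_append)
    moreover have "w \<le> int (k div K) * m"
      using Cons.prems(2)[of 0] Cons.prems(4) by (simp add: vs)
    \<comment> \<open>The group just served moves from position 0 to \<open>K - 1\<close>, and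
      \<open>k + K\<close> counts exactly one value more than \<open>k\<close>.\<close>
    moreover have "(Suc k + j) div K = k div K + 1"
      using j Cons.prems(4) div_add_self2[of K k] by (metis Suc_eq_plus1 add_Suc_shift neq0_conv)
    ultimately show ?thesis
      using Cons.prems(3) by (simp add: algebra_simps)
  qed
  moreover have "length (rotate_add vs r) = K"
    using Cons.prems(1) by (simp add: vs rotate_add_def)
  ultimately show ?case
    using Cons.hyps[of "rotate_add vs r" "Suc k"] Cons.prems by simp
qed simp

lemma foldl_round_robin_length:
  assumes "gs \<noteq> []" "\<forall>s \<in> set gs. length (fst s) = m" "\<forall>s \<in> set ss. length (fst s) = m"
  shows "length (foldl round_robin gs ss) = length gs \<and>
    (\<forall>s \<in> set (foldl round_robin gs ss). length (fst s) = m)"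
  using assms
proof (induct ss arbitrary: gs)
  case (Cons s ss)
  then obtain g hs where "gs = g # hs"
    by (cases gs) auto
  with Cons.prems have "round_robin gs s \<noteq> []" "length (round_robin gs s) = length gs"
    "\<forall>t \<in> set (round_robin gs s). length (fst t) = m"
    by (auto simp: round_robin_def add_scenario_def)
  with Cons.hyps[of "round_robin gs s"] Cons.prems(3) show ?case
    by simp
qed simp

text \<open>Here \<open>K\<close> is the number of groups, and the factor is the largest group size,
  the number of scenarios divided by \<open>K\<close> and rounded up. A sum of nonnegative regrets
  is at least each summand and at most their number times the largest.\<close>

lemma gval_grouped:
  assumes ss: "ss \<noteq> []" "\<And>s. s \<in> set ss \<Longrightarrow> length (fst s) = length x"
    and nonneg: "\<And>s. s \<in> set ss \<Longrightarrow> 0 \<le> scenario_value s x" and K: "0 < K"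
  defines "gs \<equiv> foldl round_robin (replicate K (replicate (length x) 0, 0)) ss"
  shows "gval ss x \<le> gval gs x" "gval gs x \<le> int ((length ss + K - 1) div K) * gval ss x"
proof -
  let ?rs = "map (\<lambda>s. scenario_value s x) ss"
  let ?vs = "foldl rotate_add (replicate K 0) ?rs"
  have "dot (replicate m 0) y = 0" for m y
    unfolding dot_def by (induct m arbitrary: y) (auto simp: zip_Cons1 split: list.split)
  then have zero: "scenario_value (replicate (length x) 0, 0) x = 0"
    by (simp add: scenario_value_def)
  have vs: "map (\<lambda>s. scenario_value s x) gs = ?vs"
    unfolding gs_def using K ss(2)
    by (subst scenario_values_round_robin) (auto simp: zero)
  have max_gs: "gval gs x = Max (set ?vs)"
    unfolding vs[symmetric] by (simp add: gval_eq)
  have max_ss: "gval ss x = Max (set ?rs)"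
    by (simp add: gval_eq)
  have "Max (set ?rs) \<in> set ?rs"
    using ss(1) by (intro Max_in) auto
  then obtain v where "v \<in> set ?vs" "gval ss x \<le> v"
    using rotate_add_lower[of "replicate K 0" ?rs "Max (set ?rs)"] nonneg K
    unfolding max_ss by fastforce
  then show "gval ss x \<le> gval gs x"
    unfolding max_gs by (meson List.finite_set Max_ge order_trans)
  have max0: "0 \<le> gval ss x"
    using \<open>Max (set ?rs) \<in> set ?rs\<close> nonneg unfolding max_ss by auto
  have upper: "length ?vs = K" "\<And>j. j < K \<Longrightarrow> ?vs ! j \<le> int ((length ss + j) div K) * gval ss x"
    using rotate_add_upper[of "replicate K 0" K 0 "gval ss x" ?rs] K max0
    by (auto simp: max_ss)
  have "v \<le> int ((length ss + K - 1) div K) * gval ss x" if "v \<in> set ?vs" for v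
  proof -
    from that upper(1) obtain j where j: "j < K" "v = ?vs ! j"
      by (auto simp: in_set_conv_nth)
    \<comment> \<open>The last position, \<open>j = K - 1\<close>, holds a fullest group.\<close>
    have "(length ss + j) div K \<le> (length ss + K - 1) div K"
      using j(1) by (intro div_le_mono) simp
    then have "int ((length ss + j) div K) * gval ss x \<le> int ((length ss + K - 1) div K) * gval ss x"
      using max0 by (intro mult_right_mono) simp_all
    with upper(2)[OF j(1)] j(2) show ?thesis by simp
  qed
  moreover have "set ?vs \<noteq> {}"
    using upper(1) K by auto
  ultimately show "gval gs x \<le> int ((length ss + K - 1) div K) * gval ss x"
    unfolding max_gs by simp
qed

section \<open>Integral scaling\<close>

text \<open>The plain product stands in for the least common multiple; its bit length is at most the
  sum of those of the factors.\<close>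

definition common_denominator :: "rat list list \<Rightarrow> int" where
  "common_denominator cs = prod_list (map (\<lambda>c. prod_list (map (\<lambda>r. snd (quotient_of r)) c)) cs)"

text \<open>For a multiple \<open>M\<close> of all denominators the division is exact, and the
  entries are \<open>M\<close> times the given rationals.\<close>

definition scale :: "int \<Rightarrow> rat list \<Rightarrow> int list" where
  "scale M c = map (\<lambda>r. fst (quotient_of r) * (M div snd (quotient_of r))) c"

lemma enc_rat_eq: "enc_rat r = Node (Leaf (fst (quotient_of r))) (Leaf (snd (quotient_of r)))"
  by (simp add: enc_rat_def case_prod_unfold)

lemma common_denominator_pos: "0 < common_denominator cs"
proof -
  have pos: "(\<And>x. x \<in> set xs \<Longrightarrow> 0 < x) \<Longrightarrow> 0 < prod_list xs" for xs :: "int list"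
    by (induct xs) auto
  show ?thesis
    unfolding common_denominator_def by (auto intro!: pos quotient_of_denom_pos')
qed

lemma prod_list_dvd: "x \<in> set xs \<Longrightarrow> x dvd prod_list (xs :: int list)"
  by (induct xs) auto

lemma cost_scale:
  assumes "c \<in> set cs" "length x = length c"
  shows "of_int (dot (scale (common_denominator cs) c) x) =
    of_int (common_denominator cs) * cost (map real_of_rat c) x"
proof -
  let ?M = "common_denominator cs"
  have scale: "real_of_int (scale ?M c ! j) = of_int ?M * real_of_rat (c ! j)" if "j < length c" for j
  proof -
    let ?p = "fst (quotient_of (c ! j))" and ?q = "snd (quotient_of (c ! j))"
    have "?q dvd prod_list (map (\<lambda>r. snd (quotient_of r)) c)"
      using that by (intro prod_list_dvd) auto
    also have "\<dots> dvd ?M"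
      unfolding common_denominator_def using assms(1) by (intro prod_list_dvd) auto
    finally have "?M = ?q * (?M div ?q)"
      by simp
    then have M: "real_of_int ?M = of_int ?q * of_int (?M div ?q)"
      by (metis of_int_mult)
    have "c ! j = of_int ?p / of_int ?q"
      by (rule quotient_of_div) simp
    then have "real_of_rat (c ! j) = of_int ?p / of_int ?q"
      by (metis of_rat_divide of_rat_of_int_eq)
    with M quotient_of_denom_pos'[of "c ! j"] that show ?thesis
      by (simp add: scale_def)
  qed
  have "dot (scale ?M c) x = (\<Sum>j<length c. scale ?M c ! j * x ! j)"
    using assms(2) by (simp add: dot_def scale_def sum_list_sum_nth atLeast0LessThan)
  then have "of_int (dot (scale ?M c) x) = (\<Sum>j<length c. real_of_int (scale ?M c ! j) * of_int (x ! j))"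
    by simp
  also have "\<dots> = (\<Sum>j<length c. of_int ?M * (real_of_rat (c ! j) * of_int (x ! j)))"
    by (intro sum.cong) (auto simp: scale)
  finally show ?thesis
    by (simp add: cost_def sum_distrib_left)
qed

lemma ptime_common_denominator:
  assumes "ptime D e (\<lambda>a. enc_list (enc_list enc_rat) (cs a))"
  shows "ptime D e (\<lambda>a. Leaf (common_denominator (cs a)))"
  unfolding common_denominator_def
proof (rule ptime_prod_list, rule ptime_map[OF assms], rule ptime_prod_list, rule ptime_map[OF ptime_R])
  let ?E = "{p. fst p \<in> D \<and> snd p \<in> set (cs (fst p))}"
  show "ptime {p. fst p \<in> ?E \<and> snd p \<in> set (snd (fst p))}
      (\<lambda>p. Node (Node (e (fst (fst p))) (enc_list enc_rat (snd (fst p)))) (enc_rat (snd p)))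
      (\<lambda>p. Leaf (snd (quotient_of (snd p))))"
    unfolding enc_rat_eq by (rule ptime_RR)
qed

lemma ptime_scale:
  assumes c: "ptime D e (\<lambda>a. enc_list enc_rat (c a))" and M: "ptime D e (\<lambda>a. Leaf (M a))"
  shows "ptime D e (\<lambda>a. enc_list enc_int (scale (M a) (c a)))"
  unfolding scale_def
proof (rule ptime_map[OF c], rule ptime_enc_int, rule ptime_mult)
  let ?E = "{p. fst p \<in> D \<and> snd p \<in> set (c (fst p))}"
  let ?e = "\<lambda>p. Node (e (fst p)) (enc_rat (snd p))"
  show "ptime ?E ?e (\<lambda>p. Leaf (fst (quotient_of (snd p))))"
    unfolding enc_rat_eq by (rule ptime_RL)
  have "ptime ?E ?e (\<lambda>p. Leaf (snd (quotient_of (snd p))))"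
    unfolding enc_rat_eq by (rule ptime_RR)
  moreover have "ptime ?E ?e (\<lambda>p. Leaf (M (fst p)))"
    by (rule ptime_env[OF M ptime_L]) simp
  ultimately show "ptime ?E ?e (\<lambda>p. Leaf (M (fst p) div snd (quotient_of (snd p))))"
    by (intro ptime_div)
qed

text \<open>\<open>K\<close> is a constant of the program, which is unrolled by induction on
  \<open>K\<close>.\<close>

lemma ptime_replicate:
  assumes "ptime D e (\<lambda>a. h (x a))"
  shows "ptime D e (\<lambda>a. enc_list h (replicate K (x a)))"
proof (induct K)
  case 0
  show ?case by (simp add: ptime_const)
next
  case (Suc K)
  from ptime_Cons[OF assms this] show ?case by simp
qed

section \<open>The approximation algorithm\<close>

theorem theorem2:
  fixes inst :: "bool list set"
    and n :: "bool list \<Rightarrow> nat"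
    and X :: "bool list \<Rightarrow> int list set"
    and \<epsilon> :: real
  assumes "problem_class inst n X"
    and "0 < \<epsilon>" and "\<epsilon> \<le> 1"
    and "\<And>K' :: nat. K' \<ge> 1 \<Longrightarrow>
      \<exists>P. poly_time_approx P (gen_instances inst n K') enc_gen (\<lambda>(I, _). X I) gen_obj (\<lambda>_. 2)"
  shows "\<exists>P. poly_time_approx P (regret_instances inst n) enc_regret (\<lambda>(I, _). X I)
    (regret_obj X) (\<lambda>(_, cs). \<epsilon> * real (length cs))"
proof -
  define G where "G = nat \<lceil>2 / \<epsilon>\<rceil>"
  have G: "2 / \<epsilon> \<le> real G"
    unfolding G_def by linarith
  with assms(2) have G1: "1 \<le> G"
    by (cases G) (auto simp: divide_le_0_iff)
  obtain sol1 where
    sol1_ptime: "ptime (int_gen_instances inst n 1) enc_int_gen (\<lambda>i. enc_list Leaf (sol1 i))" and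
    sol1: "\<forall>i \<in> int_gen_instances inst n 1. sol1 i \<in> X (fst i) \<and>
      (\<forall>y \<in> X (fst i). gval (snd i) (sol1 i) \<le> gval (snd i) y)"
    using exact_solver[OF assms(1) order_refl] assms(4)[OF order_refl] by blast
  obtain sol where
    sol_ptime: "ptime (int_gen_instances inst n G) enc_int_gen (\<lambda>i. enc_list Leaf (sol i))" and
    sol: "\<forall>i \<in> int_gen_instances inst n G. sol i \<in> X (fst i) \<and>
      (\<forall>y \<in> X (fst i). gval (snd i) (sol i) \<le> gval (snd i) y)"
    using exact_solver[OF assms(1) G1] assms(4)[OF G1] by blast
  let ?D = "regret_instances inst n"
  define M where "M i = common_denominator (snd i)" for i :: "bool list \<times> rat list list"
  define cs where "cs i = map (scale (M i)) (snd i)" for i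
  \<comment> \<open>With a single scenario and constant 0 the objective is the plain cost, so this
    solution attains the optimum for \<open>c\<close>.\<close>
  define best where "best I c = sol1 (I, [(c, 0)])" for I c
  \<comment> \<open>The constant is the optimum for \<open>c\<close>, which makes the scenario value
    the regret in the scaled instance.\<close>
  define ss where "ss i = map (\<lambda>c. (c, dot c (best (fst i) c))) (cs i)" for i
  define gs where "gs i = foldl round_robin (replicate G (replicate (n (fst i)) 0, 0)) (ss i)" for i
  define x where "x i = sol (fst i, gs i)" for i
  have D: "fst i \<in> inst" "snd i \<noteq> []" "\<And>c. c \<in> set (snd i) \<Longrightarrow> length c = n (fst i)" if "i \<in> ?D" for i
    using that by (auto simp: regret_instances_def)
  have cs: "length c = n (fst i)" if "i \<in> ?D" "c \<in> set (cs i)" for i c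
    using that D(3)[OF that(1)] by (auto simp: cs_def scale_def)
  have cs_ne: "cs i \<noteq> []" if "i \<in> ?D" for i
    using D(2)[OF that] by (simp add: cs_def)
  have single: "(I, [(c, 0)]) \<in> int_gen_instances inst n 1" if "I \<in> inst" "length c = n I" for I c
    using that by (auto simp: int_gen_instances_def)
  have best: "best I c \<in> X I" "\<And>y. y \<in> X I \<Longrightarrow> dot c (best I c) \<le> dot c y"
    if "I \<in> inst" "length c = n I" for I c
    using bspec[OF sol1 single[OF that]] by (auto simp: best_def gval_def)
  have ss: "length (fst s) = n (fst i)" if "i \<in> ?D" "s \<in> set (ss i)" for i s
    using that cs[OF that(1)] by (auto simp: ss_def)
  have ss_ne: "ss i \<noteq> []" if "i \<in> ?D" for i
    using cs_ne[OF that] by (simp add: ss_def)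
  have gs: "(fst i, gs i) \<in> int_gen_instances inst n G" if i: "i \<in> ?D" for i
  proof -
    from foldl_round_robin_length[of "replicate G (replicate (n (fst i)) 0, 0)" "n (fst i)" "ss i"]
    show ?thesis
      using G1 D(1)[OF i] ss[OF i] by (auto simp: int_gen_instances_def gs_def)
  qed

  \<comment> \<open>Polynomial running time\<close>
  have rats: "ptime ?D enc_regret (\<lambda>i. enc_list (enc_list enc_rat) (snd i))"
    by (rule ptime_cong[OF ptime_snd[OF ptime_cong[OF ptime_id]]])
      (auto simp: enc_regret_def case_prod_unfold)
  have bits: "ptime ?D enc_regret (\<lambda>i. enc_bits (fst i))"
    by (rule ptime_cong[OF ptime_fst[OF ptime_cong[OF ptime_id]]])
      (auto simp: enc_regret_def case_prod_unfold)
  have M: "ptime ?D enc_regret (\<lambda>i. Leaf (M i))"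
    unfolding M_def by (rule ptime_common_denominator[OF rats])
  have cs_ptime: "ptime ?D enc_regret (\<lambda>i. enc_list (enc_list enc_int) (cs i))"
    unfolding cs_def
    by (rule ptime_map[OF rats], rule ptime_scale[OF ptime_R], rule ptime_env[OF M ptime_L]) simp
  have ss_ptime: "ptime ?D enc_regret (\<lambda>i. enc_list enc_scenario (ss i))"
    unfolding ss_def
  proof (rule ptime_map[OF cs_ptime])
    let ?E = "{p. fst p \<in> ?D \<and> snd p \<in> set (cs (fst p))}"
    let ?e = "\<lambda>p. Node (enc_regret (fst p)) (enc_list enc_int (snd p))"
    have E: "fst (fst p) \<in> inst" "length (snd p) = n (fst (fst p))" if "p \<in> ?E" for p
      using that D(1) cs by auto
    have c: "ptime ?E ?e (\<lambda>p. enc_list enc_int (snd p))"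
      by (rule ptime_R)
    have "ptime ?E ?e (\<lambda>p. enc_bits (fst (fst p)))"
      by (rule ptime_env[OF bits ptime_L]) simp
    with c have "ptime ?E ?e (\<lambda>p. enc_int_gen (fst (fst p), [(snd p, 0)]))"
      unfolding enc_int_gen_def enc_scenario_def enc_list.simps fst_conv snd_conv
      by (intro ptime_Node ptime_const)
    then have "ptime ?E ?e (\<lambda>p. enc_list Leaf (best (fst (fst p)) (snd p)))"
      unfolding best_def by (rule ptime_env[OF sol1_ptime _ single[OF E]])
    then have "ptime ?E ?e (\<lambda>p. Leaf (dot (snd p) (best (fst (fst p)) (snd p))))"
    proof (rule ptime_dot[OF c])
      fix p assume "p \<in> ?E"
      note E = E[OF this]
      from problem_classD(3)[OF assms(1) E(1) best(1)[OF E]] E(2)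
      show "length (snd p) = length (best (fst (fst p)) (snd p))" by simp
    qed
    with c show "ptime ?E ?e (\<lambda>p. enc_scenario (snd p, dot (snd p) (best (fst (fst p)) (snd p))))"
      unfolding enc_scenario_def fst_conv snd_conv by (intro ptime_Node ptime_enc_int)
  qed
  \<comment> \<open>The dimension \<open>n\<close> is an abstract function of the bit string. A zero
    vector of the right length is therefore made from the first scenario of the input.\<close>
  have "ptime ?D enc_regret (\<lambda>i. enc_list enc_int (map (\<lambda>_. 0) (hd (cs i))))"
    by (rule ptime_map[OF ptime_hd[OF cs_ptime cs_ne] ptime_const])
  then have "ptime ?D enc_regret (\<lambda>i. enc_list enc_int (replicate (n (fst i)) 0))"
    by (rule ptime_cong) (simp add: map_replicate_const cs[OF _ hd_in_set[OF cs_ne]])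
  then have "ptime ?D enc_regret (\<lambda>i. enc_scenario (replicate (n (fst i)) 0, 0))"
    unfolding enc_scenario_def fst_conv snd_conv by (intro ptime_Node ptime_const)
  from ptime_replicate[where h = enc_scenario, OF this, of G]
  have "ptime ?D enc_regret (\<lambda>i. enc_list enc_scenario (gs i))"
    unfolding gs_def by (rule ptime_round_robin[OF ss_ptime]) (use ss G1 in auto)
  with bits have "ptime ?D enc_regret (\<lambda>i. enc_int_gen (fst i, gs i))"
    unfolding enc_int_gen_def fst_conv snd_conv by (intro ptime_Node)
  then have "ptime ?D enc_regret (\<lambda>i. enc_list Leaf (x i))"
    unfolding x_def by (rule ptime_env[OF sol_ptime]) (simp add: gs)
  from ptime_polyD[OF this] obtain P q where
    Pq: "\<forall>i \<in> ?D. \<exists>t. run P (enc_regret i) (enc_list Leaf (x i)) t \<and> t \<le> poly q (tsize (enc_regret i))"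
    by (elim exE)

  \<comment> \<open>The maximum regret as an integral objective\<close>
  have obj: "of_int (M i) * regret_obj X i y = of_int (gval (ss i) y)"
    if i: "i \<in> ?D" and y: "y \<in> X (fst i)" for i y
  proof -
    note X = problem_classD[OF assms(1) D(1)[OF i]]
    have M0: "0 < real_of_int (M i)"
      by (simp add: M_def common_denominator_pos)
    let ?r = "\<lambda>c. cost (map real_of_rat c) y - opt (X (fst i)) (map real_of_rat c)"
    let ?s = "\<lambda>c. (scale (M i) c, dot (scale (M i) c) (best (fst i) (scale (M i) c)))"
    have "of_int (M i) * ?r c = real_of_int (scenario_value (?s c) y)" if c: "c \<in> set (snd i)" for c
    proof -
      let ?b = "best (fst i) (scale (M i) c)"
      have len: "length (scale (M i) c) = n (fst i)"
        using D(3)[OF i c] by (simp add: scale_def)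
      note b = best[OF D(1)[OF i] len]
      have cost: "of_int (dot (scale (M i) c) z) = of_int (M i) * cost (map real_of_rat c) z"
        if "z \<in> X (fst i)" for z
        unfolding M_def using cost_scale[OF c] X(3)[OF that] D(3)[OF i c] by simp
      have "opt (X (fst i)) (map real_of_rat c) = cost (map real_of_rat c) ?b"
        unfolding opt_def
      proof (rule Min_eqI)
        fix v assume "v \<in> cost (map real_of_rat c) ` X (fst i)"
        then obtain z where z: "z \<in> X (fst i)" "v = cost (map real_of_rat c) z"
          by blast
        have "of_int (M i) * cost (map real_of_rat c) ?b \<le> of_int (M i) * v"
          using b(2)[OF z(1)] unfolding z(2) cost[OF z(1), symmetric] cost[OF b(1), symmetric] by simp
        with M0 show "cost (map real_of_rat c) ?b \<le> v"
          by simp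
      qed (use X b(1) in auto)
      then show ?thesis
        using cost[OF y] cost[OF b(1)] by (simp add: scenario_value_def right_diff_distrib)
    qed
    then have eq: "(\<lambda>v. of_int (M i) * v) ` ?r ` set (snd i) =
        real_of_int ` (\<lambda>s. scenario_value s y) ` ?s ` set (snd i)"
      unfolding image_image by (intro image_cong) auto
    have "of_int (M i) * regret_obj X i y = of_int (M i) * Max (?r ` set (snd i))"
      by (simp add: regret_obj_def max_regret_def case_prod_unfold image_image)
    also have "\<dots> = Max ((\<lambda>v. of_int (M i) * v) ` ?r ` set (snd i))"
      \<comment> \<open>Scaling by a positive factor is monotone and therefore commutes with
        \<open>Max\<close>.\<close>
      using D(2)[OF i] M0 by (intro mono_Max_commute) (auto simp: mono_def)
    also have "\<dots> = of_int (Max ((\<lambda>s. scenario_value s y) ` ?s ` set (snd i)))"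
      unfolding eq using D(2)[OF i] by (intro mono_Max_commute[symmetric]) (auto simp: mono_def)
    also have "?s ` set (snd i) = set (ss i)"
      by (simp add: ss_def cs_def image_image)
    finally show ?thesis
      by (simp add: gval_eq)
  qed

  \<comment> \<open>The approximation guarantee\<close>
  show ?thesis
    unfolding poly_time_approx_def
  proof (intro exI[of _ P] exI[of _ q] ballI)
    fix i assume i: "i \<in> ?D"
    note X = problem_classD[OF assms(1) D(1)[OF i]]
    let ?X = "X (fst i)" and ?f = "regret_obj X i" and ?K = "length (snd i)"
    let ?c = "(?K + G - 1) div G"
    obtain t where t: "run P (enc_regret i) (enc_list Leaf (x i)) t" "t \<le> poly q (tsize (enc_regret i))"
      using Pq i by blast
    have x: "x i \<in> ?X" "\<And>y. y \<in> ?X \<Longrightarrow> gval (gs i) (x i) \<le> gval (gs i) y"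
      using bspec[OF sol gs[OF i]] by (auto simp: x_def)
    have M0: "0 < real_of_int (M i)"
      by (simp add: M_def common_denominator_pos)
    have nonneg: "0 \<le> scenario_value s y" if "s \<in> set (ss i)" "y \<in> ?X" for s y
      using that best(2)[OF D(1)[OF i] cs[OF i]] by (auto simp: ss_def scenario_value_def)
    have group: "gval (ss i) y \<le> gval (gs i) y" "gval (gs i) y \<le> int ?c * gval (ss i) y" if y: "y \<in> ?X" for y
    proof -
      have len: "length (ss i) = ?K" "length y = n (fst i)"
        using X(3)[OF y] by (auto simp: ss_def cs_def)
      show "gval (ss i) y \<le> gval (gs i) y" "gval (gs i) y \<le> int ?c * gval (ss i) y"
        using gval_grouped[of "ss i" y G] ss_ne[OF i] ss[OF i] nonneg[OF _ y] G1
        unfolding gs_def len by auto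
    qed
    have f0: "0 \<le> ?f y" if y: "y \<in> ?X" for y
    proof -
      have "gval (ss i) y \<in> (\<lambda>s. scenario_value s y) ` set (ss i)"
        unfolding gval_eq using ss_ne[OF i] by (intro Max_in) auto
      then have "0 \<le> real_of_int (gval (ss i) y)"
        using nonneg[OF _ y] by auto
      with M0 show ?thesis
        unfolding obj[OF i y, symmetric] by (simp add: zero_le_mult_iff)
    qed
    have fx: "?f (x i) \<le> real ?c * ?f y" if y: "y \<in> ?X" for y
    proof -
      \<comment> \<open>The chain runs from the regret of \<open>x i\<close> to its grouped value,
        by optimality to the grouped value of \<open>y\<close>, and back to the regret of
        \<open>y\<close> with the factor \<open>?c\<close>.\<close>
      have "gval (ss i) (x i) \<le> int ?c * gval (ss i) y"
        using group(1)[OF x(1)] x(2)[OF y] group(2)[OF y] by linarith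
      then have "real_of_int (gval (ss i) (x i)) \<le> real_of_int (int ?c * gval (ss i) y)"
        by (simp only: of_int_le_iff)
      then have "of_int (M i) * ?f (x i) \<le> of_int (M i) * (real ?c * ?f y)"
        unfolding mult.left_commute[of "real_of_int (M i)" "real ?c"] obj[OF i x(1)] obj[OF i y] by simp
      with M0 show ?thesis
        by simp
    qed
    have "approximation (\<epsilon> * real ?K) ?X ?f (x i)"
      if approx: "\<exists>y. approximation (\<epsilon> * real ?K) ?X ?f y"
    proof -
      have \<alpha>: "0 \<le> \<epsilon> * real ?K"
        using assms(2) by simp
      note iff = approximation_iff[OF X(1,2) \<alpha>]
      from approx obtain z where z: "z \<in> ?X" "\<forall>y \<in> ?X. ?f z \<le> \<epsilon> * real ?K * ?f y"
        unfolding iff by blast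
      have K1: "1 \<le> ?K"
        using D(2)[OF i] by (simp add: Suc_leI)
      have "?f (x i) \<le> \<epsilon> * real ?K * ?f y" if y: "y \<in> ?X" for y
      proof (cases "?K \<le> G")
        case True
        \<comment> \<open>Every group holds at most one scenario, so \<open>x i\<close> minimises
          the regret itself. The ratio may be below 1 here; the bound is inherited from the assumed
          approximation \<open>z\<close>.\<close>
        have "?c = 1"
          using K1 True G1 by (intro div_nat_eqI) auto
        with fx[OF z(1)] z(2) y show ?thesis
          by fastforce
      next
        case False
        have "real ?c \<le> real (?K + G - 1) / real G"
          by (rule of_nat_div_le_of_nat)
        \<comment> \<open>More scenarios than groups:
          \<open>?K + G - 1 \<le> 2 * ?K\<close>.\<close>
        also have "\<dots> \<le> 2 * real ?K / real G"
          using False by (intro divide_right_mono) auto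
        also have "\<dots> \<le> \<epsilon> * real ?K"
        proof -
          have "2 \<le> \<epsilon> * real G"
            using G assms(2) by (simp add: field_simps)
          then have "2 * real ?K \<le> \<epsilon> * real G * real ?K"
            by (intro mult_right_mono) auto
          with G1 show ?thesis
            by (simp add: field_simps)
        qed
        finally have "real ?c * ?f y \<le> \<epsilon> * real ?K * ?f y"
          using f0[OF y] by (rule mult_right_mono)
        with fx[OF y] show ?thesis
          by linarith
      qed
      with x(1) show ?thesis
        unfolding iff by blast
    qed
    with t x(1) show "\<exists>x t. run P (enc_regret i) (enc_list Leaf x) t \<and> t \<le> poly q (tsize (enc_regret i)) \<and>
        x \<in> (case i of (I, _) \<Rightarrow> X I) \<and>
        ((\<exists>y. approximation (case i of (_, cs) \<Rightarrow> \<epsilon> * real (length cs)) (case i of (I, _) \<Rightarrow> X I) (regret_obj X i) y) \<longrightarrow>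
          approximation (case i of (_, cs) \<Rightarrow> \<epsilon> * real (length cs)) (case i of (I, _) \<Rightarrow> X I) (regret_obj X i) x)"
      unfolding case_prod_unfold by blast
  qed
qed

end
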